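(* Let $p\ge 3$ be a prime, let $\bar\alpha=(\alpha_1,\dots,\alpha_{p-1})\in\mathbb{GF}(p)^{p-1}$ be a nonsymmetric vector with $\sum_{i=1}^{p-1}\alpha_i=0$, and let $\Gamma_{\bar\alpha}$ be the corresponding $EGS$-group. Then the profinite completion $\hat\Gamma_{\bar\alpha}$ of $\Gamma_{\bar\alpha}$ is the projective limit of the inverse system of finite $p$-groups $$1\xleftarrow{\ \varepsilon_1\ }\Gamma_{\bar\alpha}/\mathcal{H}_1\xleftarrow{\ \varepsilon_2\ }\Gamma_{\bar\alpha}/\mathcal{H}_2\xleftarrow{\ \varepsilon_3\ }\cdots\xleftarrow{\ \varepsilon_n\ }\Gamma_{\bar\alpha}/\mathcal{H}_n\xleftarrow{\ \varepsilon_{n+1}\ }\cdots,$$ where the $\varepsilon_i$ are the natural projections.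
   Context: Let $A=\{0,1,\dots,p-1\}$ and let $T$ be the regular rooted $p$-tree whose vertices are the finite words over $A$ (root = empty word, $w$ joined to $wx$ for $x\in A$); $|v|$ is the length of the word $v$. Automorphisms of $T$ (fixing the root) act on the right, $v\mapsto v^g$. If $g\in\mathrm{Aut}\,T$ fixes a vertex $v$, then $g_v\in\mathrm{Aut}\,T$ is defined by $(vw)^g=v(w^{g_v})$ for all words $w$. Let $a,b,c\in\mathrm{Aut}\,T$ be given by: $(jw)^a=(j+1 \bmod p)\,w$ for $j\in A$; $(jw)^b=j\,(w^{a^{\alpha_{j+1}}})$ for $0\le j\le p-2$ and $((p-1)w)^b=(p-1)(w^b)$; $(0w)^c=0(w^c)$ and $(jw)^c=j\,(w^{a^{\alpha_j}})$ for $1\le j\le p-1$. The $EGS$-group is $\Gamma_{\bar\alpha}=\langle a,b,c\rangle$. The vector $\bar\alpha$ is symmetric if $\alpha_i=\alpha_{p-i}$ for all $i=1,\dots,\frac{p-1}{2}$, and nonsymmetric otherwise. For $n\ge 1$, $\mathcal{H}_n$ is the subgroup of all $h\in\mathrm{Aut}\,T$ that fix every vertex of length $n$ and satisfy $h_v\in[\Gamma_{\bar\alpha},\Gamma_{\bar\alpha}]$ for every vertex $v$ with $|v|=n$ (so $\mathcal{H}_n$ is a direct product of $p^n$ copies of $[\Gamma_{\bar\alpha},\Gamma_{\bar\alpha}]$). It is known that $\mathcal{H}_n\le\Gamma_{\bar\alpha}$ and $\mathcal{H}_1\ge\mathcal{H}_2\ge\cdots$. *)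

theory Defs
  imports
    "HOL-Algebra.Product_Groups"
    "HOL-Analysis.Function_Topology"
    "HOL-Combinatorics.Permutations"
    "HOL-Number_Theory.Residues"
begin

section \<open>Projective limits and profinite completions\<close>

text \<open>The projective limit of groups \<open>G i\<close>, \<open>i \<in> I\<close>, along bonding maps
  \<open>\<phi> i j : G j \<rightarrow> G i\<close>, one for every \<open>(i, j) \<in> E\<close>. For a tower it suffices that \<open>E\<close>
  consists of the pairs \<open>(n, Suc n)\<close>; the maps between non-adjacent levels are composites.\<close>

definition projective_limit ::
  "'i set \<Rightarrow> ('i \<times> 'i) set \<Rightarrow> ('i \<Rightarrow> ('a, 'm) monoid_scheme) \<Rightarrow> ('i \<Rightarrow> 'i \<Rightarrow> 'a \<Rightarrow> 'a)
    \<Rightarrow> ('i \<Rightarrow> 'a) monoid" where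
  "projective_limit I E G \<phi> =
    (product_group I G)
      \<lparr>carrier := {x \<in> carrier (product_group I G). \<forall>(i, j)\<in>E. \<phi> i j (x j) = x i}\<rparr>"

definition projective_limit_topology ::
  "'i set \<Rightarrow> ('i \<times> 'i) set \<Rightarrow> ('i \<Rightarrow> ('a, 'm) monoid_scheme) \<Rightarrow> ('i \<Rightarrow> 'i \<Rightarrow> 'a \<Rightarrow> 'a)
    \<Rightarrow> ('i \<Rightarrow> 'a) topology" where
  "projective_limit_topology I E G \<phi> =
    subtopology (product_topology (\<lambda>i. discrete_topology (carrier (G i))) I)
      (carrier (projective_limit I E G \<phi>))"

text \<open>The natural projection \<open>G/N \<rightarrow> G/M\<close> for normal subgroups \<open>N \<subseteq> M\<close>: it sends the
  coset \<open>N #> g\<close> to \<open>M <#> (N #> g) = M #> g\<close>.\<close>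

definition quotient_projection ::
  "('a, 'm) monoid_scheme \<Rightarrow> 'a set \<Rightarrow> 'a set \<Rightarrow> 'a set" where
  "quotient_projection G M = (\<lambda>C. M <#>\<^bsub>G\<^esub> C)"

definition finite_index_normals :: "('a, 'm) monoid_scheme \<Rightarrow> 'a set set" where
  "finite_index_normals G = {N. N \<lhd> G \<and> finite (rcosets\<^bsub>G\<^esub> N)}"

definition profinite_completion ::
  "('a, 'm) monoid_scheme \<Rightarrow> ('a set \<Rightarrow> 'a set) monoid" where
  "profinite_completion G =
    projective_limit (finite_index_normals G)
      {(M, N) \<in> finite_index_normals G \<times> finite_index_normals G. N \<subseteq> M}
      (\<lambda>N. G Mod N) (\<lambda>M N. quotient_projection G M)"

definition profinite_topology ::
  "('a, 'm) monoid_scheme \<Rightarrow> ('a set \<Rightarrow> 'a set) topology" where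
  "profinite_topology G =
    projective_limit_topology (finite_index_normals G)
      {(M, N) \<in> finite_index_normals G \<times> finite_index_normals G. N \<subseteq> M}
      (\<lambda>N. G Mod N) (\<lambda>M N. quotient_projection G M)"

definition profinite_map :: "('a, 'm) monoid_scheme \<Rightarrow> 'a \<Rightarrow> 'a set \<Rightarrow> 'a set" where
  "profinite_map G g = (\<lambda>N\<in>finite_index_normals G. N #>\<^bsub>G\<^esub> g)"

definition tower_limit ::
  "('a, 'm) monoid_scheme \<Rightarrow> (nat \<Rightarrow> 'a set) \<Rightarrow> (nat \<Rightarrow> 'a set) monoid" where
  "tower_limit G K =
    projective_limit UNIV {(n, Suc n) |n. True} (\<lambda>n. G Mod K n)
      (\<lambda>m n. quotient_projection G (K m))"

definition tower_topology ::
  "('a, 'm) monoid_scheme \<Rightarrow> (nat \<Rightarrow> 'a set) \<Rightarrow> (nat \<Rightarrow> 'a set) topology" where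
  "tower_topology G K =
    projective_limit_topology UNIV {(n, Suc n) |n. True} (\<lambda>n. G Mod K n)
      (\<lambda>m n. quotient_projection G (K m))"

definition tower_map ::
  "('a, 'm) monoid_scheme \<Rightarrow> (nat \<Rightarrow> 'a set) \<Rightarrow> 'a \<Rightarrow> nat \<Rightarrow> 'a set" where
  "tower_map G K g = (\<lambda>n. K n #>\<^bsub>G\<^esub> g)"

definition finite_p_group :: "nat \<Rightarrow> ('a, 'm) monoid_scheme \<Rightarrow> bool" where
  "finite_p_group p G \<longleftrightarrow> group G \<and> finite (carrier G) \<and> (\<exists>k. order G = p ^ k)"


section \<open>Automorphisms of the regular rooted tree\<close>

abbreviation words :: "nat \<Rightarrow> nat list set" where
  "words p \<equiv> lists {..<p}"

definition adjacent :: "nat list \<Rightarrow> nat list \<Rightarrow> bool" where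
  "adjacent u v \<longleftrightarrow> (\<exists>x. v = u @ [x]) \<or> (\<exists>x. u = v @ [x])"

text \<open>An automorphism is represented by a function on all lists that is the identity off the
  vertex set. Automorphisms act on the right, so \<open>g \<otimes> h\<close> applies \<open>g\<close> first.\<close>

definition tree_aut :: "nat \<Rightarrow> (nat list \<Rightarrow> nat list) monoid" where
  "tree_aut p =
    \<lparr>carrier = {g. g permutes words p \<and> g [] = [] \<and>
        (\<forall>u\<in>words p. \<forall>v\<in>words p. adjacent (g u) (g v) \<longleftrightarrow> adjacent u v)},
     monoid.mult = (\<lambda>g h. h \<circ> g),
     one = id\<rparr>"

text \<open>For an automorphism \<open>g\<close> fixing the vertex \<open>v\<close>, this is the automorphism \<open>g\<^sub>v\<close>
  with \<open>g (v @ w) = v @ g\<^sub>v w\<close>.\<close>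

definition section_at :: "(nat list \<Rightarrow> nat list) \<Rightarrow> nat list \<Rightarrow> nat list \<Rightarrow> nat list" where
  "section_at g v = (\<lambda>w. drop (length v) (g (v @ w)))"


section \<open>EGS-groups\<close>

text \<open>The vector \<open>(\<alpha>\<^sub>1, \<dots>, \<alpha>\<^sub>p\<^sub>-\<^sub>1)\<close> over \<open>GF(p)\<close> is a function \<open>\<alpha>\<close> with values in
  \<open>residue_ring p\<close>; only \<open>\<alpha> 1, \<dots>, \<alpha> (p - 1)\<close> are used.\<close>

definition symmetric_vector :: "nat \<Rightarrow> (nat \<Rightarrow> int) \<Rightarrow> bool" where
  "symmetric_vector p \<alpha> \<longleftrightarrow> (\<forall>i\<in>{1..(p - 1) div 2}. \<alpha> i = \<alpha> (p - i))"

primrec gen_a :: "nat \<Rightarrow> nat list \<Rightarrow> nat list" where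
  "gen_a p [] = []"
| "gen_a p (j # w) = (if j # w \<in> words p then ((j + 1) mod p) # w else j # w)"

primrec gen_b :: "nat \<Rightarrow> (nat \<Rightarrow> int) \<Rightarrow> nat list \<Rightarrow> nat list" where
  "gen_b p \<alpha> [] = []"
| "gen_b p \<alpha> (j # w) =
    (if j < p - 1 then j # (gen_a p [^]\<^bsub>tree_aut p\<^esub> \<alpha> (j + 1)) w
     else if j = p - 1 then j # gen_b p \<alpha> w
     else j # w)"

primrec gen_c :: "nat \<Rightarrow> (nat \<Rightarrow> int) \<Rightarrow> nat list \<Rightarrow> nat list" where
  "gen_c p \<alpha> [] = []"
| "gen_c p \<alpha> (j # w) =
    (if j = 0 then j # gen_c p \<alpha> w
     else if j < p then j # (gen_a p [^]\<^bsub>tree_aut p\<^esub> \<alpha> j) w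
     else j # w)"

definition EGS :: "nat \<Rightarrow> (nat \<Rightarrow> int) \<Rightarrow> (nat list \<Rightarrow> nat list) monoid" where
  "EGS p \<alpha> =
    (tree_aut p)\<lparr>carrier := generate (tree_aut p) {gen_a p, gen_b p \<alpha>, gen_c p \<alpha>}\<rparr>"

definition level_group :: "nat \<Rightarrow> (nat \<Rightarrow> int) \<Rightarrow> nat \<Rightarrow> (nat list \<Rightarrow> nat list) set" where
  "level_group p \<alpha> n =
    {h \<in> carrier (tree_aut p). \<forall>v\<in>words p. length v = n \<longrightarrow>
      h v = v \<and> section_at h v \<in> derived (EGS p \<alpha>) (carrier (EGS p \<alpha>))}"

text \<open>The inverse system starts with the trivial group \<open>\<Gamma>/\<Gamma>\<close> in position \<open>0\<close>
  (not with \<open>\<Gamma>/[\<Gamma>, \<Gamma>]\<close>, which is what \<open>level_group p \<alpha> 0\<close> would give).\<close>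

definition egs_tower :: "nat \<Rightarrow> (nat \<Rightarrow> int) \<Rightarrow> nat \<Rightarrow> (nat list \<Rightarrow> nat list) set" where
  "egs_tower p \<alpha> n = (if n = 0 then carrier (EGS p \<alpha>) else level_group p \<alpha> n)"

end

theory Submission
  imports Defs "HOL-Algebra.Sylow"
begin

text \<open>
  Write \<open>\<Gamma>\<close> for the group, \<open>\<Gamma>'\<close> for its commutator subgroup, \<open>\<gamma>\<^sub>3 = [\<Gamma>', \<Gamma>]\<close>, and \<open>S\<close> for the
  stabilizer of the first level of the tree. For \<open>x \<in> \<Gamma>\<close> let \<open>x@0\<close> be the automorphism that acts as \<open>x\<close>
  below the vertex \<open>0\<close> and trivially elsewhere. A coherent family of cosets over all normal
  subgroups of finite index is determined by its members on a cofinal chain, so the theorem says two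
  things: the subgroups \<open>\<H>\<^sub>n\<close> are normal in \<open>\<Gamma>\<close> with quotients that are finite \<open>p\<close>-groups, and every normal
  subgroup of finite index contains one of them.

  The first part rests on the inclusion \<open>\<Gamma>'@0 \<subseteq> \<gamma>\<^sub>3\<close> (\<open>derived_subset_L\<close>); it gives
  \<open>\<H>\<^sub>1 \<subseteq> \<gamma>\<^sub>3 \<subseteq> \<Gamma>'\<close>, and from this \<open>\<H>\<^sub>n\<^sub>+\<^sub>1 \<subseteq> \<H>\<^sub>n \<subseteq> \<Gamma>\<close> follows level by level.
  The quotients are finite because \<open>\<Gamma>/\<Gamma>'\<close> is finite and \<open>S/\<H>\<^sub>n\<^sub>+\<^sub>1\<close> embeds into a power of
  \<open>\<Gamma>/\<H>\<^sub>n\<close> (of \<open>\<Gamma>/\<Gamma>'\<close> for \<open>n = 0\<close>), and they are \<open>p\<close>-groups because \<open>p\<close>-th powers are in \<open>\<Gamma>'\<close>, first in \<open>\<Gamma>\<close>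
  and then in its sections. To prove the inclusion, let \<open>L\<close> be
  the set of all \<open>x\<close> with \<open>x@0 \<in> \<gamma>\<^sub>3\<close>, a normal subgroup. The shift of \<open>b\<close> by one place and \<open>c\<close> have
  the same sections except at \<open>0\<close>, so \<open>(c\<^sup>-\<^sup>1 b)@0 \<in> \<Gamma>\<close>; as every element of \<open>\<Gamma>\<close> is a section of an
  element of \<open>\<Gamma>'\<close>, the element \<open>c\<^sup>-\<^sup>1 b\<close> is central modulo \<open>L\<close>. It remains to place \<open>t = [c, a]\<close> in \<open>L\<close>.
  Choose \<open>i\<close> such that the entries \<open>v\<close> and \<open>u\<close> of the vector at \<open>-i\<close> and \<open>i\<close> differ and \<open>v \<noteq> 0\<close>, and
  write \<open>c\<^sub>k\<close> for the conjugate of \<open>c\<close> by \<open>a\<^sup>k\<close>. The commutator \<open>[c, c\<^sub>i]\<close> has nontrivial sections at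
  \<open>0\<close> and \<open>i\<close> only, and the product of all \<open>c\<^sub>k\<close> with \<open>k \<noteq> i\<close> has a trivial section at \<open>i\<close>, because
  the entries of the vector add up to zero, and the section \<open>c a\<^sup>-\<^sup>v\<close> at \<open>0\<close>. Hence \<open>t\<close> commutes
  modulo \<open>L\<close> with \<open>c a\<^sup>-\<^sup>v\<close>, similarly with \<open>c a\<^sup>-\<^sup>u\<close>, and as \<open>u \<noteq> v\<close> it is central modulo \<open>L\<close>
  (\<open>commutator_t_in_L\<close>). Now \<open>[c c\<^sub>i\<^sup>-\<^sup>1, c] \<in> \<gamma>\<^sub>3\<close> has, modulo \<open>L\<close>, the section \<open>t\<^sup>v\<close> at \<open>0\<close>, the
  section \<open>t\<^sup>-\<^sup>u\<close> at \<open>i\<close> and trivial sections elsewhere. The vectors of exponents of \<open>t\<close> obtained in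
  this way form an ideal in the group ring of the cyclic group of order \<open>p\<close>. It contains
  \<open>v - u X\<close> for a translation \<open>X\<close>, hence the constant \<open>v\<^sup>p - u\<^sup>p\<close>, which is prime to \<open>p\<close>, and
  therefore \<open>t \<in> L\<close> (\<open>t_in_L\<close>).

  For the second part, the group is infinite because its proper subgroup \<open>S\<close> maps onto it, so a normal
  subgroup \<open>N\<close> of finite index has an element \<open>g \<noteq> 1\<close>. If \<open>g\<close> moves the first level, commutators
  of \<open>g\<close> with elements \<open>X@0\<close>, followed by commutators with other elements supported below \<open>0\<close>, show
  that \<open>N\<close> contains the elements of \<open>\<gamma>\<^sub>3\<close> acting below a vertex of the second level, hence also
  \<open>\<H>\<^sub>3\<close>. If \<open>g\<close> fixes the first level, the argument is applied to a nontrivial section of \<open>g\<close> and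
  to the normal subgroup of all \<open>x\<close> with \<open>x@0 \<in> N\<close> instead
  (\<open>normal_contains_level\<close>).

  Both parts use only how \<open>a\<close>, \<open>b\<close>, \<open>c\<close> act on sections at the first level, and they are
  proved in a locale that abstracts from the tree.
\<close>

section \<open>Profinite completions along cofinal towers\<close>

context group
begin

lemma set_mult_absorb:
  assumes "subgroup M G" "subgroup N G" "N \<subseteq> M"
  shows "M <#> N = M"
proof -
  have "m \<in> M <#> N" if "m \<in> M" for m
  proof -
    have "m = m \<otimes> \<one>" "\<one> \<in> N"
      using that assms subgroup.mem_carrier subgroup.one_closed by fastforce+
    with that show ?thesis unfolding set_mult_def by blast
  qed
  then show ?thesis
    using assms by (auto simp: set_mult_def intro: subgroup.m_closed)
qed

lemma quotient_projection_rcos: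
  assumes "subgroup M G" "subgroup N G" "N \<subseteq> M" "g \<in> carrier G"
  shows "quotient_projection G M (N #> g) = M #> g"
  unfolding quotient_projection_def
  using assms by (simp add: setmult_rcos_assoc subgroup.subset set_mult_absorb)

lemma quotient_projection_epi:
  assumes "M \<lhd> G" "N \<lhd> G" "N \<subseteq> M"
  shows "quotient_projection G M \<in> epi (G Mod N) (G Mod M)"
proof -
  have sub: "subgroup M G" "subgroup N G"
    using assms normal_imp_subgroup by auto
  note proj = quotient_projection_rcos[OF sub assms(3)]
  show ?thesis
    unfolding epi_def hom_def
    using proj assms
    by (auto simp: carrier_FactGroup normal.rcos_sum image_iff Pi_iff)
qed

lemma quotient_projection_trans:
  assumes "subgroup M G" "subgroup N G" "subgroup P G" "N \<subseteq> M" "M \<subseteq> P"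
    and "C \<in> carrier (G Mod N)"
  shows "quotient_projection G P (quotient_projection G M C) = quotient_projection G P C"
proof -
  obtain g where "g \<in> carrier G" "C = N #> g"
    using assms(6) by (auto simp: carrier_FactGroup)
  with assms show ?thesis
    by (simp add: quotient_projection_rcos subset_trans[OF assms(4,5)])
qed

lemma quotient_projection_self:
  assumes "subgroup M G" "C \<in> carrier (G Mod M)"
  shows "quotient_projection G M C = C"
  using assms by (auto simp: carrier_FactGroup quotient_projection_rcos)

end

lemma carrier_projective_limit:
  "carrier (projective_limit I E G \<phi>) =
     {x \<in> (\<Pi>\<^sub>E i\<in>I. carrier (G i)). \<forall>(i, j)\<in>E. \<phi> i j (x j) = x i}"
  by (simp add: projective_limit_def)

lemma topspace_projective_limit_topology:
  "topspace (projective_limit_topology I E G \<phi>) = carrier (projective_limit I E G \<phi>)"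
  by (auto simp: projective_limit_topology_def carrier_projective_limit)

text \<open>The factors are discrete, so a coordinate that is computed from a single coordinate of the argument
  is continuous, whatever the function \<open>f\<close> that computes it.\<close>

lemma continuous_map_projective_limits:
  assumes into: "\<And>x. x \<in> carrier (projective_limit I E G \<phi>) \<Longrightarrow>
      F x \<in> carrier (projective_limit J D H \<psi>)"
    and coord: "\<And>j. j \<in> J \<Longrightarrow> \<exists>i\<in>I. \<exists>f.
      \<forall>x\<in>carrier (projective_limit I E G \<phi>). F x j = f (x i) \<and> f (x i) \<in> carrier (H j)"
  shows "continuous_map (projective_limit_topology I E G \<phi>) (projective_limit_topology J D H \<psi>) F"
proof -
  let ?X = "projective_limit_topology I E G \<phi>"
  have "continuous_map ?X (discrete_topology (carrier (H j))) (\<lambda>x. F x j)" if j: "j \<in> J" for j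
  proof -
    obtain i f where i: "i \<in> I" and f: "\<And>x. x \<in> carrier (projective_limit I E G \<phi>) \<Longrightarrow>
        F x j = f (x i) \<and> f (x i) \<in> carrier (H j)"
      using coord[OF j] by blast
    let ?c = "carrier (projective_limit I E G \<phi>)"
    have ev: "continuous_map ?X (discrete_topology (carrier (G i))) (\<lambda>x. x i)"
      unfolding projective_limit_topology_def
      by (intro continuous_map_from_subtopology continuous_map_product_projection i)
    let ?T = "discrete_topology ((\<lambda>x. x i) ` ?c)"
    have ev': "continuous_map ?X ?T (\<lambda>x. x i)"
      using continuous_map_in_subtopology[of ?X "discrete_topology (carrier (G i))" "(\<lambda>x. x i) ` ?c"]
      ev i
      by (auto simp: topspace_projective_limit_topology carrier_projective_limit PiE_iff Int_absorb1 image_subset_iff)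
    have "continuous_map ?T (discrete_topology (carrier (H j))) f"
      using f by auto
    from continuous_map_compose[OF ev' this]
    have "continuous_map ?X (discrete_topology (carrier (H j))) (f \<circ> (\<lambda>x. x i))" .
    then show ?thesis
      by (rule continuous_map_eq) (simp add: f topspace_projective_limit_topology)
  qed
  moreover have "F x \<in> extensional J" if "x \<in> topspace ?X" for x
    using into[of x] that
    by (auto simp: topspace_projective_limit_topology carrier_projective_limit PiE_def)
  ultimately show ?thesis
    unfolding projective_limit_topology_def[of J]
    using into
    by (auto simp: continuous_map_in_subtopology continuous_map_componentwise
        topspace_projective_limit_topology)
qed

text \<open>A coherent family over all normal subgroups of finite index is determined by its
  members on a cofinal tower, and a coherent family on the tower extends: below every \<open>N\<close>
  there is some \<open>K n\<close>, whose member projects to the one at \<open>N\<close>. This does not depend on \<open>n\<close>. The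
  inverse of \<open>\<Phi>\<close> built in this way reads only one coordinate of the tower for each \<open>N\<close> and
  is therefore continuous.\<close>

theorem (in group) profinite_completion_cofinal_tower:
  assumes fin: "\<And>n. K n \<in> finite_index_normals G"
    and decr: "\<And>n. K (Suc n) \<subseteq> K n"
    and cofinal: "\<And>N. N \<in> finite_index_normals G \<Longrightarrow> \<exists>n. K n \<subseteq> N"
  shows "\<exists>\<Phi>. \<Phi> \<in> iso (profinite_completion G) (tower_limit G K)
           \<and> homeomorphic_map (profinite_topology G) (tower_topology G K) \<Phi>
           \<and> (\<forall>g\<in>carrier G. \<Phi> (profinite_map G g) = tower_map G K g)"
proof -
  define \<N> where "\<N> = finite_index_normals G"
  define \<Phi> where "\<Phi> = (\<lambda>(x :: 'a set \<Rightarrow> 'a set) n. x (K n))"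
  define lev where "lev N = (SOME n. K n \<subseteq> N)" for N
  define \<Psi> where "\<Psi> = (\<lambda>(y :: nat \<Rightarrow> 'a set). \<lambda>N\<in>\<N>. quotient_projection G N (y (lev N)))"
  let ?P = "carrier (profinite_completion G)" and ?T = "carrier (tower_limit G K)"
  have topspaces: "topspace (profinite_topology G) = ?P" "topspace (tower_topology G K) = ?T"
    by (simp_all add: profinite_topology_def tower_topology_def profinite_completion_def
        tower_limit_def topspace_projective_limit_topology)
  have KN: "K n \<in> \<N>" for n
    using fin by (simp add: \<N>_def)
  have sub: "subgroup N G" if "N \<in> \<N>" for N
    using that by (auto simp: \<N>_def finite_index_normals_def normal_imp_subgroup)
  have nor: "N \<lhd> G" if "N \<in> \<N>" for N
    using that by (auto simp: \<N>_def finite_index_normals_def)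
  have lev: "K (lev N) \<subseteq> N" if "N \<in> \<N>" for N
    using cofinal[of N] that someI_ex[of "\<lambda>n. K n \<subseteq> N"] by (auto simp: \<N>_def lev_def)
  have anti: "K n \<subseteq> K m" if "m \<le> n" for m n
    using that by (induction n rule: dec_induct) (use decr in auto)
  have P_iff: "x \<in> ?P \<longleftrightarrow> x \<in> (\<Pi>\<^sub>E N\<in>\<N>. carrier (G Mod N)) \<and>
      (\<forall>M\<in>\<N>. \<forall>N\<in>\<N>. N \<subseteq> M \<longrightarrow> quotient_projection G M (x N) = x M)" for x
    unfolding profinite_completion_def carrier_projective_limit \<N>_def by auto
  have T_iff: "y \<in> ?T \<longleftrightarrow> (\<forall>n. y n \<in> carrier (G Mod K n)) \<and>
      (\<forall>n. quotient_projection G (K n) (y (Suc n)) = y n)" for y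
    unfolding tower_limit_def carrier_projective_limit by auto
  have T_proj: "quotient_projection G (K m) (y n) = y m" if y: "y \<in> ?T" and mn: "m \<le> n" for y m n
    using mn
  proof (induction n rule: dec_induct)
    case base
    then show ?case using y sub[OF KN] by (auto simp: T_iff quotient_projection_self)
  next
    case (step n)
    have "quotient_projection G (K m) (y (Suc n))
        = quotient_projection G (K m) (quotient_projection G (K n) (y (Suc n)))"
      using y sub[OF KN] decr anti[OF step(1)]
      by (intro quotient_projection_trans[of _ "K (Suc n)", symmetric]) (auto simp: T_iff)
    then show ?case using y step by (simp add: T_iff)
  qed
  have T_indep: "quotient_projection G N (y n) = quotient_projection G N (y m)"
    if y: "y \<in> ?T" and N: "N \<in> \<N>" "K m \<subseteq> N" "K n \<subseteq> N" for y N m n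
  proof -
    have *: "quotient_projection G N (y k) = quotient_projection G N (y l)"
      if "K k \<subseteq> N" "k \<le> l" for k l
      using quotient_projection_trans[OF sub[OF KN] sub[OF KN] sub[OF N(1)] anti[OF that(2)] that(1), of "y l"]
        T_proj[OF y that(2)] y by (simp add: T_iff)
    show ?thesis
      using *[OF N(2), of n] *[OF N(3), of m] by (metis nle_le)
  qed
  have \<Phi>_in: "\<Phi> x \<in> ?T" if "x \<in> ?P" for x
    unfolding T_iff
  proof (intro conjI allI)
    show "\<Phi> x n \<in> carrier (G Mod K n)" for n
      using that KN[of n] by (auto simp: P_iff \<Phi>_def)
    show "quotient_projection G (K n) (\<Phi> x (Suc n)) = \<Phi> x n" for n
      using that KN[of n] KN[of "Suc n"] decr[of n] by (simp add: P_iff \<Phi>_def)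
  qed
  have epi: "quotient_projection G M C \<in> carrier (G Mod M)"
    if "M \<in> \<N>" "N \<in> \<N>" "N \<subseteq> M" "C \<in> carrier (G Mod N)" for M N C
    using quotient_projection_epi[OF nor nor, of M N] that by (auto simp: epi_def)
  have \<Psi>_in: "\<Psi> y \<in> ?P" if y: "y \<in> ?T" for y
    unfolding P_iff
  proof (intro conjI ballI impI)
    show "\<Psi> y \<in> (\<Pi>\<^sub>E N\<in>\<N>. carrier (G Mod N))"
      using y epi[OF _ KN lev] by (auto simp: \<Psi>_def T_iff)
  next
    fix M N assume MN: "M \<in> \<N>" "N \<in> \<N>" "N \<subseteq> M"
    have "quotient_projection G M (\<Psi> y N) = quotient_projection G M (y (lev N))"
      using quotient_projection_trans[OF sub[OF MN(2)] sub[OF KN] sub[OF MN(1)] lev[OF MN(2)] MN(3), of "y (lev N)"]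
        y MN by (simp add: \<Psi>_def T_iff)
    also have "\<dots> = \<Psi> y M"
      using T_indep[OF y MN(1) lev[OF MN(1)], of "lev N"] lev[OF MN(2)] MN by (simp add: \<Psi>_def)
    finally show "quotient_projection G M (\<Psi> y N) = \<Psi> y M" .
  qed
  have \<Psi>\<Phi>: "\<Psi> (\<Phi> x) = x" if "x \<in> ?P" for x
  proof
    fix N show "\<Psi> (\<Phi> x) N = x N"
      using that KN lev by (cases "N \<in> \<N>") (auto simp: P_iff \<Psi>_def \<Phi>_def PiE_def extensional_def)
  qed
  have \<Phi>\<Psi>: "\<Phi> (\<Psi> y) = y" if y: "y \<in> ?T" for y
  proof
    fix n
    have "\<Phi> (\<Psi> y) n = quotient_projection G (K n) (y n)"
      using T_indep[OF y KN order_refl lev[OF KN], of n] KN by (simp add: \<Phi>_def \<Psi>_def)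
    then show "\<Phi> (\<Psi> y) n = y n"
      using T_proj[OF y] by simp
  qed
  have "\<Phi> \<in> hom (profinite_completion G) (tower_limit G K)"
    unfolding hom_def
    using \<Phi>_in KN
    by (auto simp: profinite_completion_def tower_limit_def projective_limit_def \<Phi>_def \<N>_def)
  moreover have "bij_betw \<Phi> ?P ?T"
    by (rule bij_betwI[where g = \<Psi>]) (use \<Phi>_in \<Psi>_in \<Psi>\<Phi> \<Phi>\<Psi> in auto)
  ultimately have "\<Phi> \<in> iso (profinite_completion G) (tower_limit G K)"
    by (simp add: iso_def)
  moreover have "homeomorphic_map (profinite_topology G) (tower_topology G K) \<Phi>"
    unfolding homeomorphic_map_maps
  proof (intro exI[of _ \<Psi>], unfold homeomorphic_maps_def, intro conjI)
    show "continuous_map (profinite_topology G) (tower_topology G K) \<Phi>"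
      unfolding profinite_topology_def tower_topology_def
    proof (rule continuous_map_projective_limits; fold profinite_completion_def tower_limit_def)
      show "\<exists>i\<in>finite_index_normals G. \<exists>f. \<forall>x\<in>?P. \<Phi> x j = f (x i) \<and> f (x i) \<in> carrier (G Mod K j)" for j
        using KN[of j] by (intro bexI[of _ "K j"] exI[of _ id]) (auto simp: \<Phi>_def P_iff \<N>_def)
    qed (use \<Phi>_in in auto)
    show "continuous_map (tower_topology G K) (profinite_topology G) \<Psi>"
      unfolding profinite_topology_def tower_topology_def
    proof (rule continuous_map_projective_limits; fold profinite_completion_def tower_limit_def)
      show "\<exists>i\<in>UNIV. \<exists>f. \<forall>y\<in>?T. \<Psi> y N = f (y i) \<and> f (y i) \<in> carrier (G Mod N)"
        if "N \<in> finite_index_normals G" for N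
        using that epi[OF _ KN lev, of N]
        by (intro bexI[of _ "lev N"] exI[of _ "quotient_projection G N"])
          (auto simp: \<Psi>_def \<N>_def T_iff)
    qed (use \<Psi>_in in auto)
  qed (use \<Psi>\<Phi> \<Phi>\<Psi> in \<open>simp_all add: topspaces\<close>)
  moreover have "\<forall>g\<in>carrier G. \<Phi> (profinite_map G g) = tower_map G K g"
    using KN by (auto simp: \<Phi>_def profinite_map_def tower_map_def \<N>_def)
  ultimately show ?thesis
    by blast
qed

section \<open>Commutators modulo a normal subgroup\<close>

definition commutator :: "('a, 'm) monoid_scheme \<Rightarrow> 'a \<Rightarrow> 'a \<Rightarrow> 'a" where
  "commutator G x y = x \<otimes>\<^bsub>G\<^esub> y \<otimes>\<^bsub>G\<^esub> inv\<^bsub>G\<^esub> x \<otimes>\<^bsub>G\<^esub> inv\<^bsub>G\<^esub> y"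

lemma (in group_hom) preimage_subgroup:
  assumes "subgroup K H"
  shows "subgroup {x \<in> carrier G. h x \<in> K} G"
proof -
  interpret K: subgroup K H by fact
  show ?thesis by (rule G.subgroupI) auto
qed

context group
begin

lemma inv_cancel_left: "x \<in> carrier G \<Longrightarrow> y \<in> carrier G \<Longrightarrow> inv x \<otimes> (x \<otimes> y) = y"
  by (simp flip: m_assoc)

lemma cancel_inv_left: "x \<in> carrier G \<Longrightarrow> y \<in> carrier G \<Longrightarrow> x \<otimes> (inv x \<otimes> y) = y"
  by (simp flip: m_assoc)

lemmas word_simps = m_assoc inv_mult_group inv_cancel_left cancel_inv_left

lemma commutator_closed [simp, intro]:
  "x \<in> carrier G \<Longrightarrow> y \<in> carrier G \<Longrightarrow> commutator G x y \<in> carrier G"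
  by (simp add: commutator_def)

lemma commutator_eq_one_iff:
  assumes "x \<in> carrier G" "y \<in> carrier G"
  shows "commutator G x y = \<one> \<longleftrightarrow> x \<otimes> y = y \<otimes> x"
proof
  assume "commutator G x y = \<one>"
  then have "commutator G x y \<otimes> (y \<otimes> x) = y \<otimes> x"
    using assms by simp
  then show "x \<otimes> y = y \<otimes> x"
    using assms by (simp add: commutator_def word_simps)
next
  assume "x \<otimes> y = y \<otimes> x"
  then have "commutator G x y = y \<otimes> x \<otimes> inv x \<otimes> inv y"
    by (simp add: commutator_def)
  then show "commutator G x y = \<one>"
    using assms by (simp add: word_simps)
qed

lemma commutator_one [simp]:
  "x \<in> carrier G \<Longrightarrow> commutator G x \<one> = \<one>" "x \<in> carrier G \<Longrightarrow> commutator G \<one> x = \<one>"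
  by (simp_all add: commutator_def)

lemma commutator_conj:
  assumes "x \<in> carrier G" "y \<in> carrier G" "g \<in> carrier G"
  shows "g \<otimes> commutator G x y \<otimes> inv g = commutator G (g \<otimes> x \<otimes> inv g) (g \<otimes> y \<otimes> inv g)"
  using assms by (simp add: commutator_def word_simps)

lemma commutator_in_normal:
  assumes "N \<lhd> G" "x \<in> carrier G" "y \<in> carrier G" "x \<in> N \<or> y \<in> N"
  shows "commutator G x y \<in> N"
proof -
  interpret N: normal N G by fact
  consider "x \<in> N" | "y \<in> N" using assms by blast
  then show ?thesis
  proof cases
    case 1
    then have "x \<otimes> (y \<otimes> inv x \<otimes> inv y) \<in> N"
      using assms by (intro N.m_closed N.inv_op_closed2) auto
    then show ?thesis using assms by (simp add: commutator_def m_assoc)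
  next
    case 2
    then have "(x \<otimes> y \<otimes> inv x) \<otimes> inv y \<in> N"
      using assms by (intro N.m_closed N.inv_op_closed2) auto
    then show ?thesis by (simp add: commutator_def)
  qed
qed

lemma commutator_in_derived:
  "x \<in> carrier G \<Longrightarrow> y \<in> carrier G \<Longrightarrow> commutator G x y \<in> derived G (carrier G)"
  unfolding derived_def commutator_def by (rule generate.incl) blast

lemma commutator_derived_subset:
  assumes "subgroup N G"
    and "\<And>x y. x \<in> carrier G \<Longrightarrow> y \<in> carrier G \<Longrightarrow> commutator G x y \<in> N"
  shows "derived G (carrier G) \<subseteq> N"
  unfolding derived_def
  by (rule generate_subgroup_incl) (use assms in \<open>auto simp: commutator_def\<close>)

lemma derived_carrier_normal: "derived G (carrier G) \<lhd> G"
  using derived_is_normal normal_self by blast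

lemma mod_hom: "N \<lhd> G \<Longrightarrow> group_hom G (G Mod N) (\<lambda>x. N #> x)"
  by (simp add: group_hom_def group_hom_axioms_def is_group normal.factorgroup_is_group
      normal.r_coset_hom_Mod)

lemma mem_normal_iff:
  assumes "N \<lhd> G" "x \<in> carrier G"
  shows "x \<in> N \<longleftrightarrow> N #> x = \<one>\<^bsub>G Mod N\<^esub>"
  using assms coset_join1[of N x] coset_join2[of x N] normal_imp_subgroup by auto

lemma commutator_mem_iff:
  assumes "N \<lhd> G" "x \<in> carrier G" "y \<in> carrier G"
  shows "commutator G x y \<in> N \<longleftrightarrow>
    (N #> x) \<otimes>\<^bsub>G Mod N\<^esub> (N #> y) = (N #> y) \<otimes>\<^bsub>G Mod N\<^esub> (N #> x)"
proof -
  interpret h: group_hom G "G Mod N" "\<lambda>x. N #> x"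
    using assms(1) by (rule mod_hom)
  have "N #> commutator G x y = commutator (G Mod N) (N #> x) (N #> y)"
    using assms by (simp add: commutator_def del: mult_FactGroup)
  then show ?thesis
    using assms by (simp add: mem_normal_iff h.H.commutator_eq_one_iff del: mult_FactGroup one_FactGroup)
qed

lemma commutator_mem_commute:
  assumes "N \<lhd> G" "x \<in> carrier G" "y \<in> carrier G"
  shows "commutator G x y \<in> N \<longleftrightarrow> commutator G y x \<in> N"
  using assms by (auto simp: commutator_mem_iff)

lemma centralizer_subgroup:
  assumes "x \<in> carrier G"
  shows "subgroup {y \<in> carrier G. x \<otimes> y = y \<otimes> x} G"
proof (rule subgroupI, goal_cases)
  case 2
  show ?case using assms by (auto intro!: exI[of _ "\<one>"])
next
  case (3 y)
  then have "inv y \<otimes> (y \<otimes> x) \<otimes> inv y = inv y \<otimes> (x \<otimes> y) \<otimes> inv y"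
    by simp
  then have "x \<otimes> inv y = inv y \<otimes> x"
    using 3[THEN CollectD, THEN conjunct1] assms by (simp add: word_simps)
  then show ?case using 3 by simp
next
  case (4 y z)
  then have "x \<otimes> (y \<otimes> z) = y \<otimes> x \<otimes> z"
    using assms by (simp flip: m_assoc)
  with 4 assms show ?case by (simp add: m_assoc)
qed auto

lemma centralizer_mod_subgroup:
  assumes "N \<lhd> G" "x \<in> carrier G"
  shows "subgroup {y \<in> carrier G. commutator G x y \<in> N} G"
proof -
  interpret h: group_hom G "G Mod N" "\<lambda>x. N #> x"
    using assms(1) by (rule mod_hom)
  let ?C = "{q \<in> carrier (G Mod N). (N #> x) \<otimes>\<^bsub>G Mod N\<^esub> q = q \<otimes>\<^bsub>G Mod N\<^esub> (N #> x)}"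
  have "{y \<in> carrier G. commutator G x y \<in> N} = {y \<in> carrier G. N #> y \<in> ?C}"
    using assms h.hom_closed by (auto simp: commutator_mem_iff simp del: mult_FactGroup)
  moreover have "subgroup ?C (G Mod N)"
    using assms by (intro h.H.centralizer_subgroup h.hom_closed)
  then have "subgroup {y \<in> carrier G. N #> y \<in> ?C} G"
    by (rule h.preimage_subgroup)
  ultimately show ?thesis by simp
qed

text \<open>Commuting modulo \<open>N\<close> with a fixed element defines a subgroup, so each of the two arguments of the
  commutator can be reduced to the generators in turn.\<close>

lemma derived_subset_if_generators_commute:
  assumes N: "N \<lhd> G" and X: "X \<subseteq> carrier G" "generate G X = carrier G"
    and comm: "\<And>x y. x \<in> X \<Longrightarrow> y \<in> X \<Longrightarrow> commutator G x y \<in> N"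
  shows "derived G (carrier G) \<subseteq> N"
proof (rule commutator_derived_subset)
  have *: "commutator G x y \<in> N" if "x \<in> carrier G" "y \<in> carrier G"
    "\<And>y. y \<in> X \<Longrightarrow> commutator G x y \<in> N" for x y
  proof -
    have "carrier G \<subseteq> {y \<in> carrier G. commutator G x y \<in> N}"
      unfolding X(2)[symmetric]
      by (rule generate_subgroup_incl) (use that X centralizer_mod_subgroup[OF N] in auto)
    with that show ?thesis by blast
  qed
  fix x y assume "x \<in> carrier G" "y \<in> carrier G"
  then show "commutator G x y \<in> N"
    using * X comm commutator_mem_commute[OF N] by (meson subsetD)
qed (use N in \<open>rule normal_imp_subgroup\<close>)

lemma conj_int_pow:
  assumes "x \<in> carrier G" "g \<in> carrier G"
  shows "g \<otimes> x [^] (n :: int) \<otimes> inv g = (g \<otimes> x \<otimes> inv g) [^] n"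
proof -
  have "group_hom G G (\<lambda>x. g \<otimes> x \<otimes> inv g)"
    using assms is_group
    by (auto simp: group_hom_def group_hom_axioms_def hom_def word_simps)
  from group_hom.hom_int_pow[OF this assms(1), of n] show ?thesis .
qed

lemma commutator_central_int_pow:
  assumes "x \<in> carrier G" "y \<in> carrier G" "w \<in> carrier G" "commutator G x y = w"
    and "w \<otimes> y = y \<otimes> w"
  shows "x \<otimes> y [^] (n :: int) = w [^] n \<otimes> y [^] n \<otimes> x"
proof -
  have "w \<otimes> y = x \<otimes> y \<otimes> inv x"
    using assms by (auto simp: commutator_def word_simps)
  then have "x \<otimes> y [^] n \<otimes> inv x = w [^] n \<otimes> y [^] n"
    using assms by (simp add: conj_int_pow int_pow_mult_distrib[symmetric])
  then have "x \<otimes> y [^] n \<otimes> inv x \<otimes> x = w [^] n \<otimes> y [^] n \<otimes> x"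
    by simp
  then show ?thesis using assms by (simp add: m_assoc)
qed

lemma mem_subgroup_if_coprime_pow:
  assumes H: "subgroup H G" and x: "x \<in> carrier G" "x [^] (m :: int) \<in> H" "x [^] (n :: int) \<in> H"
    and "coprime m n"
  shows "x \<in> H"
proof -
  obtain u v where "u * m + v * n = 1"
    using bezout_int[of m n] \<open>coprime m n\<close> by auto
  then have "x = (x [^] m) [^] u \<otimes> (x [^] n) [^] v"
    using x(1) by (simp add: int_pow_pow mult.commute flip: int_pow_mult)
  then show ?thesis
    using H x subgroup_int_pow_closed subgroup.m_closed by metis
qed

end

definition third_lower_central :: "('a, 'm) monoid_scheme \<Rightarrow> 'a set" where
  "third_lower_central G =
     generate G {commutator G x y | x y. x \<in> derived G (carrier G) \<and> y \<in> carrier G}"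

context group
begin

lemma commutator_in_third:
  "x \<in> derived G (carrier G) \<Longrightarrow> y \<in> carrier G \<Longrightarrow> commutator G x y \<in> third_lower_central G"
  unfolding third_lower_central_def by (rule generate.incl) blast

lemma third_lower_central_subset:
  assumes "subgroup N G"
    and "\<And>x y. x \<in> derived G (carrier G) \<Longrightarrow> y \<in> carrier G \<Longrightarrow> commutator G x y \<in> N"
  shows "third_lower_central G \<subseteq> N"
  unfolding third_lower_central_def by (rule generate_subgroup_incl) (use assms in auto)

lemma derived_carrier_subset: "derived G (carrier G) \<subseteq> carrier G"
  by (simp add: derived_in_carrier)

lemma third_lower_central_normal: "third_lower_central G \<lhd> G"
  unfolding third_lower_central_def
proof (rule normal_generateI)
  let ?D = "derived G (carrier G)"
  interpret D: normal ?D G by (rule derived_carrier_normal)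
  show "{commutator G x y |x y. x \<in> ?D \<and> y \<in> carrier G} \<subseteq> carrier G"
    by auto
  fix h g assume "h \<in> {commutator G x y |x y. x \<in> ?D \<and> y \<in> carrier G}" and g: "g \<in> carrier G"
  then obtain x y where xy: "x \<in> ?D" "y \<in> carrier G" "h = commutator G x y" by blast
  then have "g \<otimes> h \<otimes> inv g = commutator G (g \<otimes> x \<otimes> inv g) (g \<otimes> y \<otimes> inv g)"
    using g by (simp add: commutator_conj)
  moreover have "g \<otimes> x \<otimes> inv g \<in> ?D" "g \<otimes> y \<otimes> inv g \<in> carrier G"
    using xy g D.inv_op_closed2 by auto
  ultimately show "g \<otimes> h \<otimes> inv g \<in> {commutator G x y |x y. x \<in> ?D \<and> y \<in> carrier G}"
    by blast
qed

lemma third_subset_derived: "third_lower_central G \<subseteq> derived G (carrier G)"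
  using derived_carrier_normal derived_carrier_subset
  by (intro third_lower_central_subset commutator_in_normal) (auto simp: normal_imp_subgroup)

end

section \<open>Sections at the first level\<close>

text \<open>The properties of the EGS-groups that are used below. \<open>S\<close> stands for the stabilizer of the
  first level and \<open>sec g k\<close> for the section of \<open>g\<close> at the vertex \<open>k mod p\<close>. Positions are integers,
  so that a cyclic shift of the sections is a subtraction. The function \<open>\<beta>\<close> is the vector
  extended to all integers, with the value \<open>0\<close> at the multiples of \<open>p\<close>, where the
  sections of \<open>c\<close> contain \<open>c\<close> itself instead of a power of \<open>a\<close>.\<close>

locale egs_sections = group G for G (structure) +
  fixes p :: nat and \<beta> :: "int \<Rightarrow> int" and a b c :: 'a
    and S :: "'a set" and sec :: "'a \<Rightarrow> int \<Rightarrow> 'a"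
  assumes p_prime: "prime p"
    and \<beta>_zero: "\<And>k. int p dvd k \<Longrightarrow> \<beta> k = 0"
    and \<beta>_mod: "\<And>k. \<beta> (k mod int p) = \<beta> k"
    and \<beta>_sum: "int p dvd (\<Sum>k<p. \<beta> (int k))"
    and \<beta>_nonsymmetric: "\<exists>i. \<not> int p dvd \<beta> i - \<beta> (- i)"
    and a_closed [simp]: "a \<in> carrier G" and b_closed [simp]: "b \<in> carrier G"
    and c_closed [simp]: "c \<in> carrier G"
    and generators: "generate G {a, b, c} = carrier G"
    and a_order: "a [^] p = \<one>" and b_order: "b [^] p = \<one>" and c_order: "c [^] p = \<one>"
    and S_normal: "S \<lhd> G" and a_notin_S: "a \<notin> S" and b_in_S: "b \<in> S" and c_in_S: "c \<in> S"
    and sec_closed [simp]: "\<And>g k. g \<in> S \<Longrightarrow> sec g k \<in> carrier G"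
    and sec_mult: "\<And>g h k. g \<in> S \<Longrightarrow> h \<in> S \<Longrightarrow> sec (g \<otimes> h) k = sec g k \<otimes> sec h k"
    and sec_mod: "\<And>g k. sec g (k mod int p) = sec g k"
    and sec_faithful: "\<And>g. g \<in> S \<Longrightarrow> (\<And>k. sec g k = \<one>) \<Longrightarrow> g = \<one>"
    and sec_conj_a: "\<And>g k. g \<in> S \<Longrightarrow> sec (inv a \<otimes> g \<otimes> a) k = sec g (k - 1)"
    and sec_b: "\<And>k. sec b k = (if int p dvd k + 1 then b else a [^] \<beta> (k + 1))"
    and sec_c: "\<And>k. sec c k = (if int p dvd k then c else a [^] \<beta> k)"

sublocale egs_sections \<subseteq> S: normal S G
  by (rule S_normal)

context egs_sections
begin

abbreviation G' where "G' \<equiv> derived G (carrier G)"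
abbreviation \<gamma>\<^sub>3 where "\<gamma>\<^sub>3 \<equiv> third_lower_central G"

lemma p_pos: "p > 0"
  using p_prime prime_gt_0_nat by blast

lemma prime_int: "prime (int p)"
  using p_prime by simp

lemma S_carrier [simp]: "g \<in> S \<Longrightarrow> g \<in> carrier G"
  by (rule S.mem_carrier)

lemma sec_hom: "group_hom (G\<lparr>carrier := S\<rparr>) G (\<lambda>g. sec g k)"
  using subgroup_imp_group[OF S.is_subgroup] is_group
  by (auto simp: group_hom_def group_hom_axioms_def hom_def sec_mult)

lemma sec_one [simp]: "sec \<one> k = \<one>"
  using group_hom.hom_one[OF sec_hom] by simp

lemma sec_inv: "g \<in> S \<Longrightarrow> sec (inv g) k = inv (sec g k)"
  using group_hom.hom_inv[OF sec_hom, of g k] m_inv_consistent[OF S.is_subgroup] by simp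

lemma sec_int_pow: "g \<in> S \<Longrightarrow> sec (g [^] (n :: int)) k = sec g k [^] n"
  using group_hom.hom_int_pow[OF sec_hom, of g n k] int_pow_consistent[OF S.is_subgroup, of g n] by simp

lemma sec_nat_pow: "g \<in> S \<Longrightarrow> sec (g [^] (n :: nat)) k = sec g k [^] n"
  using sec_int_pow[of g "int n"] by (simp add: int_pow_int)

lemma S_conj: "g \<in> S \<Longrightarrow> x \<in> carrier G \<Longrightarrow> x \<otimes> g \<otimes> inv x \<in> S"
  by (rule S.inv_op_closed2)

lemma S_int_pow [simp]: "g \<in> S \<Longrightarrow> g [^] (n :: int) \<in> S"
  using subgroup_int_pow_closed[OF S.is_subgroup] by blast

lemma S_nat_pow [simp]: "g \<in> S \<Longrightarrow> g [^] (n :: nat) \<in> S"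
  using S_int_pow[of g "int n"] by (simp add: int_pow_int)

lemma commutator_S [simp]: "g \<in> S \<Longrightarrow> h \<in> S \<Longrightarrow> commutator G g h \<in> S"
  by (simp add: commutator_def)

lemma sec_commutator:
  "g \<in> S \<Longrightarrow> h \<in> S \<Longrightarrow> sec (commutator G g h) k = commutator G (sec g k) (sec h k)"
  by (simp add: commutator_def sec_mult sec_inv)

lemma sec_conj:
  "g \<in> S \<Longrightarrow> x \<in> S \<Longrightarrow> sec (x \<otimes> g \<otimes> inv x) k = sec x k \<otimes> sec g k \<otimes> inv (sec x k)"
  by (simp add: sec_mult sec_inv)

lemma sec_cong: "k mod int p = l mod int p \<Longrightarrow> sec g k = sec g l"
  by (metis sec_mod)

lemma \<beta>_cong: "k mod int p = l mod int p \<Longrightarrow> \<beta> k = \<beta> l"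
  by (metis \<beta>_mod)

lemma sec_eqI:
  assumes "g \<in> S" "h \<in> S" "\<And>k. sec g k = sec h k"
  shows "g = h"
proof -
  have "g \<otimes> inv h = \<one>"
  proof (rule sec_faithful)
    show "g \<otimes> inv h \<in> S" using assms by simp
    show "sec (g \<otimes> inv h) k = \<one>" for k
      using assms(1,2) by (simp add: sec_mult sec_inv assms(3))
  qed
  then show ?thesis
    using assms(1,2) inv_equality[of g "inv h"] by simp
qed

lemma pow_eq_one:
  assumes "x \<in> carrier G" "x [^] p = \<one>" "int p dvd n"
  shows "x [^] n = \<one>"
proof -
  obtain m where "n = int p * m" using assms by (elim dvdE)
  then have "x [^] n = (x [^] int p) [^] m"
    using assms by (simp add: int_pow_pow)
  then show ?thesis
    using assms by (simp add: int_pow_int)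
qed

lemma a_pow_eq_one: "int p dvd n \<Longrightarrow> a [^] n = \<one>"
  using a_order by (intro pow_eq_one) auto

lemma coprime_p: "\<not> int p dvd n \<Longrightarrow> coprime n (int p)"
  using prime_int by (metis coprime_commute prime_imp_coprime)

lemma a_from_power:
  assumes "subgroup H G" "a [^] n \<in> H" "\<not> int p dvd n"
  shows "a \<in> H"
  using assms mem_subgroup_if_coprime_pow[of H a n "int p"] coprime_p a_pow_eq_one[of "int p"]
    subgroup.one_closed by fastforce

text \<open>Conjugation by a power of \<open>a\<close> permutes the sections cyclically; see \<open>sec_shift\<close> below.\<close>

definition shift :: "'a \<Rightarrow> int \<Rightarrow> 'a" where
  "shift g i = inv (a [^] i) \<otimes> g \<otimes> a [^] i"

lemma shift_in_normal: "M \<lhd> G \<Longrightarrow> g \<in> M \<Longrightarrow> shift g i \<in> M"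
  unfolding shift_def by (intro normal.inv_op_closed1) auto

lemma shift_in_S [simp]: "g \<in> S \<Longrightarrow> shift g i \<in> S"
  using shift_in_normal S_normal by blast

lemma shift_closed [simp]: "g \<in> carrier G \<Longrightarrow> shift g i \<in> carrier G"
  by (simp add: shift_def)

lemma shift_shift: "g \<in> carrier G \<Longrightarrow> shift (shift g i) j = shift g (i + j)"
  by (simp add: shift_def int_pow_mult word_simps)

lemma shift_0 [simp]: "g \<in> carrier G \<Longrightarrow> shift g 0 = g"
  by (simp add: shift_def)

lemma sec_shift: "g \<in> S \<Longrightarrow> sec (shift g i) k = sec g (k - i)"
proof -
  have pos: "sec (shift g (int n)) k = sec g (k - int n)" if "g \<in> S" for g n k
  proof (induction n arbitrary: k)
    case (Suc n)
    have "shift g (int (Suc n)) = inv a \<otimes> shift g (int n) \<otimes> a"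
      using shift_shift[of g "int n" 1] that by (simp add: shift_def add.commute)
    then show ?case
      using Suc that by (simp add: sec_conj_a diff_diff_eq)
  qed (use that in simp)
  assume g: "g \<in> S"
  show ?thesis
  proof (cases "i \<ge> 0")
    case True
    then show ?thesis using pos[OF g, of "nat i"] by simp
  next
    case False
    then have "sec (shift (shift g i) (- i)) (k - i) = sec (shift g i) k"
      using pos[of "shift g i" "nat (- i)" "k - i"] g by simp
    then show ?thesis
      using g by (simp add: shift_shift)
  qed
qed

text \<open>By nonsymmetry a pair of opposite entries of the vector differs; after swapping
  the two, the one at \<open>-i\<close> may be taken to be nonzero.\<close>

lemma asymmetric_index:
  obtains i where "\<not> int p dvd i" "\<not> int p dvd \<beta> (- i)" "\<not> int p dvd \<beta> (- i) - \<beta> i"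
proof -
  obtain i where i: "\<not> int p dvd \<beta> i - \<beta> (- i)"
    using \<beta>_nonsymmetric by blast
  then have "\<not> int p dvd i"
    using \<beta>_zero[of i] \<beta>_zero[of "- i"] by auto
  moreover have "\<not> int p dvd \<beta> i \<or> \<not> int p dvd \<beta> (- i)"
    using i by auto
  moreover have "\<not> int p dvd \<beta> (- i) - \<beta> i"
    using i by (simp add: dvd_diff_commute)
  ultimately show thesis
    using that[of i] that[of "- i"] i by auto
qed

lemma derived_subset_S: "G' \<subseteq> S"
proof (rule derived_subset_if_generators_commute[OF S_normal _ generators])
  fix x y assume xy: "x \<in> {a, b, c}" "y \<in> {a, b, c}"
  show "commutator G x y \<in> S"
  proof (cases "x = a \<and> y = a")
    case True
    then have "commutator G x y = \<one>" by (subst commutator_eq_one_iff) auto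
    then show ?thesis by simp
  next
    case False
    with xy show ?thesis
      using b_in_S c_in_S by (intro commutator_in_normal[OF S_normal]) auto
  qed
qed auto

lemma third_subset_S: "\<gamma>\<^sub>3 \<subseteq> S"
  using third_subset_derived derived_subset_S by blast

lemma shift_quotient_in_derived:
  assumes "g \<in> carrier G"
  shows "shift g j \<otimes> inv (shift g k) \<in> G'"
proof -
  have "shift g j \<otimes> inv (shift g k)
      = shift (commutator G (inv (a [^] (j - k))) g) k"
    using assms int_pow_mult[of a "j - k" k]
    by (simp add: shift_def commutator_def word_simps int_pow_diff)
  then show ?thesis
    using assms by (simp add: shift_in_normal[OF derived_carrier_normal] commutator_in_derived)
qed

text \<open>For \<open>X = {k. \<not> p dvd k}\<close> these are the \<open>x\<close> such that the automorphism of the tree which acts as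
  \<open>x\<close> below the vertex \<open>0\<close> and trivially elsewhere is in \<open>M\<close>: a rigid vertex stabilizer, transported
  to the whole tree. Smaller sets \<open>X\<close> serve to build elements of this one, by the
  commutator rule \<open>rigid_commutator\<close>.\<close>

definition rigid :: "'a set \<Rightarrow> int set \<Rightarrow> 'a set" where
  "rigid M X = {x. \<exists>d\<in>M \<inter> S. sec d 0 = x \<and> (\<forall>k\<in>X. sec d k = \<one>)}"

abbreviation nonzero :: "int set" where "nonzero \<equiv> {k. \<not> int p dvd k}"

lemma rigidI: "d \<in> M \<Longrightarrow> d \<in> S \<Longrightarrow> sec d 0 = x \<Longrightarrow> (\<And>k. k \<in> X \<Longrightarrow> sec d k = \<one>) \<Longrightarrow> x \<in> rigid M X"
  unfolding rigid_def by blast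

lemma rigidE:
  assumes "x \<in> rigid M X"
  obtains d where "d \<in> M" "d \<in> S" "sec d 0 = x" "\<And>k. k \<in> X \<Longrightarrow> sec d k = \<one>"
  using assms unfolding rigid_def by blast

lemma rigid_mono: "M \<subseteq> N \<Longrightarrow> Y \<subseteq> X \<Longrightarrow> rigid M X \<subseteq> rigid N Y"
  unfolding rigid_def by blast

lemma rigid_carrier: "x \<in> rigid M X \<Longrightarrow> x \<in> carrier G"
  by (auto simp: rigid_def)

lemma rigid_subgroup:
  assumes "subgroup M G"
  shows "subgroup (rigid M X) G"
proof -
  interpret M: subgroup M G by fact
  show ?thesis
  proof (rule subgroupI)
    show "rigid M X \<subseteq> carrier G" using rigid_carrier by blast
    show "rigid M X \<noteq> {}"
      by (metis M.one_closed S.one_closed rigidI sec_one empty_iff)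
  next
    fix x assume "x \<in> rigid M X"
    then obtain d where "d \<in> M" "d \<in> S" "sec d 0 = x" "\<And>k. k \<in> X \<Longrightarrow> sec d k = \<one>"
      by (rule rigidE) blast
    then show "inv x \<in> rigid M X"
      by (intro rigidI[of "inv d"]) (auto simp: sec_inv)
  next
    fix x y assume "x \<in> rigid M X" "y \<in> rigid M X"
    obtain d where "d \<in> M" "d \<in> S" "sec d 0 = x" "\<And>k. k \<in> X \<Longrightarrow> sec d k = \<one>"
      using \<open>x \<in> rigid M X\<close> by (rule rigidE) blast
    moreover obtain e where "e \<in> M" "e \<in> S" "sec e 0 = y" "\<And>k. k \<in> X \<Longrightarrow> sec e k = \<one>"
      using \<open>y \<in> rigid M X\<close> by (rule rigidE) blast
    ultimately show "x \<otimes> y \<in> rigid M X"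
      by (intro rigidI[of "d \<otimes> e"]) (auto simp: sec_mult)
  qed
qed

text \<open>A commutator is trivial wherever one of its arguments is.\<close>

lemma rigid_commutator:
  assumes "x \<in> rigid M X" "y \<in> rigid N Y"
    and "\<And>d e. d \<in> M \<Longrightarrow> e \<in> N \<Longrightarrow> d \<in> S \<Longrightarrow> e \<in> S \<Longrightarrow> commutator G d e \<in> P"
    and "Z \<subseteq> X \<union> Y"
  shows "commutator G x y \<in> rigid P Z"
proof -
  obtain d where "d \<in> M" "d \<in> S" "sec d 0 = x" "\<And>k. k \<in> X \<Longrightarrow> sec d k = \<one>"
    using assms(1) by (rule rigidE) blast
  moreover obtain e where "e \<in> N" "e \<in> S" "sec e 0 = y" "\<And>k. k \<in> Y \<Longrightarrow> sec e k = \<one>"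
    using assms(2) by (rule rigidE) blast
  ultimately show ?thesis
    using assms(3,4) by (intro rigidI[of "commutator G d e"]) (auto simp: sec_commutator)
qed

text \<open>Every element of the group is the section at \<open>0\<close> of an element of \<open>S\<close>, and even
  of an element of the commutator subgroup: the quotient of two shifts of \<open>c\<close> has
  a nonzero power of \<open>a\<close> as a section because the vector is not constant.\<close>

lemma rigid_derived_empty: "rigid G' {} = carrier G"
proof
  interpret D: normal G' G by (rule derived_carrier_normal)
  let ?R = "rigid G' {}"
  have R: "subgroup ?R G" by (intro rigid_subgroup D.is_subgroup)
  obtain i where i: "\<not> int p dvd i" "\<not> int p dvd \<beta> (- i)" "\<not> int p dvd \<beta> (- i) - \<beta> i"
    by (rule asymmetric_index)
  have R_quot: "sec g (- j) \<otimes> inv (sec g (- k)) \<in> ?R" if "g \<in> S" for g j k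
    using shift_quotient_in_derived[of g j k] that by (intro rigidI[of "shift g j \<otimes> inv (shift g k)"]) (auto simp: sec_mult sec_inv sec_shift)
  have "a [^] \<beta> (- i) \<otimes> inv (a [^] \<beta> i) \<in> ?R"
    using R_quot[OF c_in_S, of i "- i"] i by (simp add: sec_c)
  then have a: "a \<in> ?R"
    using a_from_power[OF R _ i(3)] by (simp add: int_pow_diff)
  have a_pow: "a [^] n \<in> ?R" for n :: int
    using subgroup_int_pow_closed[OF R a] .
  have "c \<otimes> inv (a [^] \<beta> (- i)) \<in> ?R"
    using R_quot[OF c_in_S, of 0 i] i by (simp add: sec_c)
  then have "(c \<otimes> inv (a [^] \<beta> (- i))) \<otimes> a [^] \<beta> (- i) \<in> ?R"
    by (rule subgroup.m_closed[OF R _ a_pow])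
  then have c: "c \<in> ?R" by (simp add: word_simps)
  have "b \<otimes> inv (a [^] \<beta> (- i)) \<in> ?R"
    using R_quot[OF b_in_S, of 1 "i + 1"] i by (simp add: sec_b)
  then have "(b \<otimes> inv (a [^] \<beta> (- i))) \<otimes> a [^] \<beta> (- i) \<in> ?R"
    by (rule subgroup.m_closed[OF R _ a_pow])
  then have b: "b \<in> ?R" by (simp add: word_simps)
  show "carrier G \<subseteq> ?R"
    using generate_subgroup_incl[of "{a, b, c}" ?R] R a b c generators by simp
  show "?R \<subseteq> carrier G" using rigid_carrier by blast
qed

lemma rigid_carrier_empty: "rigid (carrier G) {} = carrier G"
  using rigid_derived_empty rigid_mono[OF derived_carrier_subset order_refl] rigid_carrier by blast

text \<open>Conjugation by \<open>g\<close> is induced by an element of \<open>S\<close> that has the section \<open>g\<close> at \<open>0\<close>.\<close>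

lemma rigid_normal:
  assumes "M \<lhd> G"
  shows "rigid M X \<lhd> G"
  unfolding normal_inv_iff
proof (intro conjI ballI)
  interpret M: normal M G by fact
  show "subgroup (rigid M X) G" by (intro rigid_subgroup M.is_subgroup)
  fix g x assume "g \<in> carrier G" "x \<in> rigid M X"
  obtain d where d: "d \<in> M" "d \<in> S" "sec d 0 = x" "\<And>k. k \<in> X \<Longrightarrow> sec d k = \<one>"
    using \<open>x \<in> rigid M X\<close> by (rule rigidE) blast
  obtain s where s: "s \<in> S" "sec s 0 = g"
    using \<open>g \<in> carrier G\<close> rigid_carrier_empty by (blast elim: rigidE)
  have "sec (s \<otimes> d \<otimes> inv s) k = \<one>" if "k \<in> X" for k
    using d s that by (simp add: sec_conj)
  moreover have "sec (s \<otimes> d \<otimes> inv s) 0 = g \<otimes> x \<otimes> inv g"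
    using d s by (simp add: sec_conj)
  ultimately show "g \<otimes> x \<otimes> inv g \<in> rigid M X"
    using d s by (intro rigidI[of "s \<otimes> d \<otimes> inv s"] M.inv_op_closed2 S_conj) auto
qed

end

section \<open>The commutator subgroup acting below one vertex\<close>

lemma fermat_int:
  fixes x :: int
  assumes "prime p"
  shows "int p dvd x ^ p - x"
proof (cases "int p dvd x")
  case True
  then show ?thesis
    using assms by (intro dvd_diff) (auto simp: prime_gt_0_nat intro: dvd_trans[OF _ dvd_power])
next
  case False
  define y where "y = nat (x mod int p)"
  have y: "int y = x mod int p"
    using assms by (simp add: y_def prime_gt_0_nat)
  then have "\<not> p dvd y"
    using False by (metis dvd_mod_iff dvd_refl int_dvd_int_iff)
  then have "[y ^ (p - 1) = 1] (mod p)"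
    using assms by (rule fermat_theorem[rotated])
  then have "[int y ^ (p - 1) * int y = 1 * int y] (mod int p)"
    by (intro cong_mult) (simp_all flip: cong_int_iff)
  then have "[int y ^ p = int y] (mod int p)"
    using assms prime_gt_0_nat by (simp flip: power_Suc2)
  then have "[x ^ p = x] (mod int p)"
    by (simp add: y cong_def power_mod)
  then show ?thesis
    by (simp add: cong_iff_dvd_diff)
qed

context egs_sections
begin

text \<open>The commutator subgroup will be shown to lie in \<open>L\<close>. By \<open>commutator_z_in_L\<close>, the generators \<open>b\<close>
  and \<open>c\<close> differ by the element \<open>z\<close>, which is central modulo \<open>L\<close>, so that \<open>t = [c, a]\<close>, defined below,
  is the only commutator of generators that needs work.\<close>

definition z where "z = inv c \<otimes> b"

definition L where "L = rigid \<gamma>\<^sub>3 nonzero"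

lemma z_closed [simp]: "z \<in> carrier G"
  by (simp add: z_def)

lemma L_normal: "L \<lhd> G"
  unfolding L_def by (rule rigid_normal[OF third_lower_central_normal])

text \<open>The shift of \<open>b\<close> by one place and \<open>c\<close> have the same sections except at \<open>0\<close>.\<close>

lemma z_rigid: "z \<in> rigid (carrier G) nonzero"
proof (rule rigidI[of "inv c \<otimes> shift b 1"])
  show "sec (inv c \<otimes> shift b 1) 0 = z"
    using b_in_S c_in_S by (simp add: sec_mult sec_inv sec_shift sec_b sec_c z_def)
  show "sec (inv c \<otimes> shift b 1) k = \<one>" if "k \<in> nonzero" for k
    using b_in_S c_in_S that by (simp add: sec_mult sec_inv sec_shift sec_b sec_c)
qed (use b_in_S c_in_S in auto)

lemma commutator_rigid_in_L:
  assumes "x \<in> rigid G' X" "y \<in> rigid (carrier G) Y" "nonzero \<subseteq> X \<union> Y"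
  shows "commutator G x y \<in> L"
  unfolding L_def using assms(1,2)
  by (rule rigid_commutator) (use assms(3) commutator_in_third in auto)

lemma commutator_z_in_L: "g \<in> carrier G \<Longrightarrow> commutator G g z \<in> L"
  using z_rigid by (intro commutator_rigid_in_L[of g "{}"]) (auto simp: rigid_derived_empty)

lemma a_pow_cong: "int p dvd m - n \<Longrightarrow> a [^] m = a [^] n"
  using a_pow_eq_one[of "m - n"] int_pow_mult[of a "m - n" n] by simp

lemma a_pow_comm: "commutator G (a [^] (m :: int)) (a [^] (n :: int)) = \<one>"
  by (subst commutator_eq_one_iff) (auto simp: add.commute simp flip: int_pow_mult)

lemma dvd_imp_cong: "int p dvd k - l \<Longrightarrow> k mod int p = l mod int p"
  by (simp add: mod_eq_dvd_iff)

text \<open>This is witnessed by the commutator of \<open>c\<close> with its \<open>i\<close>-th shift, whose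
  sections commute everywhere except at \<open>0\<close> and \<open>i\<close>.\<close>

lemma commutator_c_a_rigid:
  assumes i: "\<not> int p dvd i" "\<not> int p dvd \<beta> (- i)"
    and X: "X \<subseteq> nonzero" "\<And>k. k \<in> X \<Longrightarrow> int p dvd k - i \<Longrightarrow> int p dvd \<beta> i"
  shows "commutator G c a \<in> rigid G' X"
proof -
  let ?d = "commutator G c (shift c i)"
  have N: "rigid G' X \<lhd> G" by (rule rigid_normal[OF derived_carrier_normal])
  have "commutator G c (a [^] \<beta> (- i)) \<in> rigid G' X"
  proof (rule rigidI[of ?d])
    show "sec ?d 0 = commutator G c (a [^] \<beta> (- i))"
      using i c_in_S by (simp add: sec_commutator sec_shift sec_c)
    fix k assume k: "k \<in> X"
    then have k0: "sec c k = a [^] \<beta> k" using X(1) by (auto simp: sec_c)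
    show "sec ?d k = \<one>"
    proof (cases "int p dvd k - i")
      case True
      then have "int p dvd \<beta> k"
        using X(2)[OF k] \<beta>_cong[OF dvd_imp_cong, of k i] by simp
      then show ?thesis
        using c_in_S k0 by (simp add: sec_commutator sec_shift a_pow_eq_one)
    next
      case False
      then show ?thesis
        using c_in_S k0 by (simp add: sec_commutator sec_shift a_pow_comm sec_c)
    qed
  qed (use c_in_S in \<open>auto intro: commutator_in_derived\<close>)
  then have "a \<in> {y \<in> carrier G. commutator G c y \<in> rigid G' X}"
    by (intro a_from_power[OF centralizer_mod_subgroup[OF N] _ i(2)]) auto
  then show ?thesis by simp
qed

lemma \<beta>_sum_shift: "int p dvd (\<Sum>k<p. \<beta> (j - int k))"
proof -
  let ?f = "\<lambda>k. nat ((j - int k) mod int p)"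
  have into: "?f ` {..<p} \<subseteq> {..<p}"
    using p_pos by (auto simp: nat_less_iff)
  have "inj_on ?f {..<p}"
  proof
    fix k l assume kl: "k \<in> {..<p}" "l \<in> {..<p}" and "?f k = ?f l"
    then have "(j - int k) mod int p = (j - int l) mod int p"
      using p_pos by (simp add: nat_eq_iff)
    then have "int p dvd (j - int k) - (j - int l)"
      by (simp only: mod_eq_dvd_iff)
    then have "int l mod int p = int k mod int p"
      by (simp add: mod_eq_dvd_iff)
    then show "k = l"
      using kl by simp
  qed
  then have "bij_betw ?f {..<p} {..<p}"
    using into by (simp add: bij_betw_def endo_inj_surj)
  then have "(\<Sum>k<p. \<beta> (int (?f k))) = (\<Sum>k<p. \<beta> (int k))"
    by (rule sum.reindex_bij_betw)
  then show ?thesis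
    using \<beta>_sum p_pos by (simp add: \<beta>_mod)
qed

text \<open>The product of all shifts of \<open>c\<close> but the \<open>i\<close>-th: at \<open>i\<close> the exponents of \<open>a\<close>
  add up to the sum of the vector, which is \<open>0\<close>, and at \<open>0\<close> to that sum without one entry.\<close>

lemma c_a_rigid:
  assumes i: "\<not> int p dvd i"
  shows "c \<otimes> a [^] (- \<beta> (- i)) \<in> rigid (carrier G) {k. int p dvd k - i}"
proof -
  define f where "f k = (if int p dvd int k - i then 0 else \<beta> (- int k))" for k
  have "\<exists>h\<in>S. sec h 0 = c \<otimes> a [^] (\<Sum>k\<in>{1..<n}. f k) \<and> sec h i = a [^] (\<Sum>k<n. \<beta> (i - int k))"
    if "1 \<le> n" "n \<le> p" for n
    using that
  proof (induction n rule: dec_induct)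
    case base
    show ?case
      using i c_in_S by (intro bexI[of _ c]) (auto simp: sec_c)
  next
    case (step n)
    then obtain h where h: "h \<in> S" "sec h 0 = c \<otimes> a [^] (\<Sum>k\<in>{1..<n}. f k)"
      "sec h i = a [^] (\<Sum>k<n. \<beta> (i - int k))" by auto
    have n: "\<not> int p dvd int n"
      using step by (auto dest: dvd_imp_le)
    show ?case
    proof (cases "int p dvd int n - i")
      case True
      then have "f n = 0" "\<beta> (i - int n) = 0"
        by (auto simp: f_def dvd_diff_commute intro: \<beta>_zero)
      with h step show ?thesis by (intro bexI[of _ h]) auto
    next
      case False
      then have "\<not> int p dvd i - int n" by (simp add: dvd_diff_commute)
      with False h n step show ?thesis
        using c_in_S
        by (intro bexI[of _ "h \<otimes> shift c (int n)"])
          (auto simp: sec_mult sec_shift sec_c f_def m_assoc int_pow_mult)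
    qed
  qed
  from this[of p] obtain h where h: "h \<in> S" "sec h 0 = c \<otimes> a [^] (\<Sum>k\<in>{1..<p}. f k)"
    "sec h i = a [^] (\<Sum>k<p. \<beta> (i - int k))"
    using p_pos by auto
  define k0 where "k0 = nat (i mod int p)"
  have k0: "int p dvd int k - i \<longleftrightarrow> k = k0" if "k < p" for k
    using that p_pos pos_mod_sign[of "int p" i] by (auto simp: k0_def mod_eq_dvd_iff[symmetric])
  have "k0 < p" using p_pos by (simp add: k0_def nat_less_iff)
  have "(\<Sum>k\<in>{1..<p}. f k) = (\<Sum>k<p. f k)"
    using p_pos by (intro sum.mono_neutral_left) (auto simp: f_def \<beta>_zero not_le)
  also have "\<dots> = (\<Sum>k<p. \<beta> (0 - int k) - (if k = k0 then \<beta> (- int k) else 0))"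
    by (intro sum.cong) (auto simp: f_def k0)
  also have "\<dots> = (\<Sum>k<p. \<beta> (0 - int k)) - \<beta> (- int k0)"
    using \<open>k0 < p\<close> by (subst sum_subtractf) simp
  also have "\<beta> (- int k0) = \<beta> (- i)"
    using p_pos by (intro \<beta>_cong) (simp add: k0_def mod_minus_eq)
  finally have "a [^] (\<Sum>k\<in>{1..<p}. f k) = a [^] (- \<beta> (- i))"
    using \<beta>_sum_shift[of 0] by (intro a_pow_cong) simp
  moreover have "a [^] (\<Sum>k<p. \<beta> (i - int k)) = \<one>"
    using \<beta>_sum_shift by (intro a_pow_eq_one)
  ultimately show ?thesis
    using h sec_cong[OF dvd_imp_cong] by (intro rigidI[of h]) auto
qed

definition t where "t = commutator G c a"

lemma t_closed [simp]: "t \<in> carrier G"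
  by (simp add: t_def)

text \<open>Modulo \<open>L\<close>, the element \<open>t\<close> commutes with \<open>c a\<^sup>-\<^sup>v\<close> and \<open>c a\<^sup>-\<^sup>u\<close> for two different entries
  \<open>v\<close> and \<open>u\<close> of the vector, hence with a nontrivial power of \<open>a\<close>, hence with \<open>a\<close> and \<open>c\<close>.\<close>

lemma commutator_t_in_L:
  assumes "g \<in> carrier G"
  shows "commutator G t g \<in> L"
proof -
  let ?C = "{y \<in> carrier G. commutator G t y \<in> L}"
  have C: "subgroup ?C G"
    by (rule centralizer_mod_subgroup[OF L_normal]) simp
  have *: "c \<otimes> a [^] (- \<beta> (- i)) \<in> ?C" if i: "\<not> int p dvd i" "\<not> int p dvd \<beta> (- i)" for i
  proof -
    have "t \<in> rigid G' {k. \<not> int p dvd k \<and> \<not> int p dvd k - i}"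
      unfolding t_def using i by (intro commutator_c_a_rigid) auto
    from commutator_rigid_in_L[OF this c_a_rigid[OF i(1)]] show ?thesis by auto
  qed
  obtain i where i: "\<not> int p dvd i" "\<not> int p dvd \<beta> (- i)" "\<not> int p dvd \<beta> (- i) - \<beta> i"
    by (rule asymmetric_index)
  have v: "c \<otimes> a [^] (- \<beta> (- i)) \<in> ?C"
    using * i by blast
  have u: "c \<otimes> a [^] (- \<beta> i) \<in> ?C"
  proof (cases "int p dvd \<beta> i")
    case True
    \<comment> \<open>Here \<open>c\<close> and its shift also commute at \<open>i\<close>, so \<open>t\<close> commutes with everything.\<close>
    have "t \<in> rigid G' nonzero"
      unfolding t_def using i True by (intro commutator_c_a_rigid) auto
    from commutator_rigid_in_L[OF this, of _ "{}"] show ?thesis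
      by (simp add: rigid_carrier_empty)
  next
    case False
    then show ?thesis using *[of "- i"] i by simp
  qed
  have "inv (c \<otimes> a [^] (- \<beta> (- i))) \<otimes> (c \<otimes> a [^] (- \<beta> i)) \<in> ?C"
    by (intro subgroup.m_closed[OF C] subgroup.m_inv_closed[OF C] u v)
  also have "inv (c \<otimes> a [^] (- \<beta> (- i))) \<otimes> (c \<otimes> a [^] (- \<beta> i)) = a [^] (\<beta> (- i) - \<beta> i)"
    by (simp add: word_simps int_pow_neg int_pow_diff)
  finally have a: "a \<in> ?C"
    using a_from_power[OF C _ i(3)] by blast
  have "c \<otimes> a [^] (- \<beta> i) \<otimes> a [^] \<beta> i \<in> ?C"
    by (intro subgroup.m_closed[OF C] u subgroup_int_pow_closed[OF C a])
  then have c: "c \<in> ?C" by (simp add: word_simps int_pow_neg)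
  have "z \<in> ?C" by (simp add: commutator_z_in_L)
  then have "c \<otimes> z \<in> ?C" by (intro subgroup.m_closed[OF C] c)
  then have "b \<in> ?C" by (simp add: z_def word_simps)
  then have "carrier G \<subseteq> ?C"
    using generate_subgroup_incl[of "{a, b, c}" ?C] C a c generators by simp
  with assms show ?thesis by blast
qed

text \<open>The required element is a product of shifts of elements of \<open>M\<close> that realize the single entries
  \<open>x k\<close> at the position \<open>0\<close>.\<close>

lemma rigid_fill:
  assumes M: "M \<lhd> G" and x: "\<And>k. x k \<in> rigid M nonzero" "\<And>k. x (k mod int p) = x k"
  shows "\<exists>d\<in>M \<inter> S. \<forall>k. sec d k = x k"
proof -
  interpret M: normal M G by fact
  have "\<exists>d\<in>M \<inter> S. \<forall>k. sec d k = (if k mod int p < int n then x k else \<one>)" if "n \<le> p" for n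
    using that
  proof (induction n)
    case 0
    have "\<not> k mod int p < 0" for k
      using p_pos pos_mod_sign[of "int p" k] by linarith
    then show ?case by (intro bexI[of _ "\<one>"]) auto
  next
    case (Suc n)
    then obtain d where d: "d \<in> M" "d \<in> S" "\<And>k. sec d k = (if k mod int p < int n then x k else \<one>)"
      by auto
    obtain e where e: "e \<in> M" "e \<in> S" "sec e 0 = x (int n)" "\<And>k. k \<in> nonzero \<Longrightarrow> sec e k = \<one>"
      using x(1) by (rule rigidE) blast
    have "sec (d \<otimes> shift e (int n)) k = (if k mod int p < int (Suc n) then x k else \<one>)" for k
    proof (cases "int p dvd k - int n")
      case True
      then have k: "k mod int p = int n"
        using Suc by (simp add: mod_eq_dvd_iff[symmetric])
      then have "sec e (k - int n) = x k"
        using e(3) True sec_cong[of "k - int n" 0 e] x(2)[of k] by (simp add: mod_eq_0_iff_dvd)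
      then show ?thesis
        using d e k rigid_carrier[OF x(1)[of k]] by (simp add: sec_mult sec_shift)
    next
      case False
      then have k: "k mod int p \<noteq> int n"
        using Suc by (auto simp: mod_eq_dvd_iff[symmetric])
      then show ?thesis
        using d e False rigid_carrier[OF x(1)[of k]] by (auto simp: sec_mult sec_shift)
    qed
    then show ?case
      using d e shift_in_normal[OF M] by (intro bexI[of _ "d \<otimes> shift e (int n)"]) auto
  qed
  from this[of p] show ?thesis using p_pos by simp
qed


abbreviation q where "q g \<equiv> L #> g"

lemma q_hom: "group_hom G (G Mod L) q"
  by (rule mod_hom[OF L_normal])

text \<open>These functions form a group that is closed under cyclic shifts, in other words (for functions of
  period \<open>p\<close>) an ideal of the group ring of the cyclic group of order \<open>p\<close> over the integers. The aim
  is to find in it a function that vanishes outside the multiples of \<open>p\<close> and has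
  a value prime to \<open>p\<close> there.\<close>

definition realized :: "(int \<Rightarrow> int) \<Rightarrow> bool" where
  "realized f \<longleftrightarrow> (\<exists>d\<in>\<gamma>\<^sub>3. \<forall>k. q (sec d k) = q t [^]\<^bsub>G Mod L\<^esub> f k)"

lemma third_normal: "\<gamma>\<^sub>3 \<lhd> G"
  by (rule third_lower_central_normal)

lemma q_t_closed: "q t \<in> carrier (G Mod L)"
  using group_hom.hom_closed[OF q_hom] by simp

lemma realized_add:
  assumes "realized f" "realized g"
  shows "realized (\<lambda>k. f k + g k)"
proof -
  interpret N: normal \<gamma>\<^sub>3 G by (rule third_normal)
  interpret q: group_hom G "G Mod L" q by (rule q_hom)
  obtain d e where "d \<in> \<gamma>\<^sub>3" "e \<in> \<gamma>\<^sub>3" "\<And>k. q (sec d k) = q t [^]\<^bsub>G Mod L\<^esub> f k"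
    "\<And>k. q (sec e k) = q t [^]\<^bsub>G Mod L\<^esub> g k"
    using assms by (auto simp: realized_def)
  moreover have "d \<in> S" "e \<in> S" using calculation third_subset_S by auto
  ultimately show ?thesis
    unfolding realized_def using q_t_closed
    by (intro bexI[of _ "d \<otimes> e"]) (auto simp: sec_mult q.H.int_pow_mult simp del: mult_FactGroup)
qed

lemma realized_scale:
  assumes "realized f"
  shows "realized (\<lambda>k. n * f k)"
proof -
  interpret N: normal \<gamma>\<^sub>3 G by (rule third_normal)
  interpret q: group_hom G "G Mod L" q by (rule q_hom)
  obtain d where "d \<in> \<gamma>\<^sub>3" "\<And>k. q (sec d k) = q t [^]\<^bsub>G Mod L\<^esub> f k"
    using assms by (auto simp: realized_def)
  moreover have "d \<in> S" using calculation third_subset_S by auto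
  ultimately show ?thesis
    unfolding realized_def using q_t_closed
    by (intro bexI[of _ "d [^] n"] subgroup_int_pow_closed N.is_subgroup)
      (auto simp: sec_int_pow q.hom_int_pow q.H.int_pow_pow mult.commute)
qed

lemma realized_shift:
  assumes "realized f"
  shows "realized (\<lambda>k. f (k - i))"
proof -
  obtain d where "d \<in> \<gamma>\<^sub>3" "\<And>k. q (sec d k) = q t [^]\<^bsub>G Mod L\<^esub> f k"
    using assms by (auto simp: realized_def)
  moreover have "d \<in> S" using calculation third_subset_S by auto
  ultimately show ?thesis
    unfolding realized_def
    by (intro bexI[of _ "shift d i"] shift_in_normal third_normal) (auto simp: sec_shift)
qed

lemma q_t_central: "g \<in> carrier G \<Longrightarrow> q t \<otimes>\<^bsub>G Mod L\<^esub> q g = q g \<otimes>\<^bsub>G Mod L\<^esub> q t"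
  using commutator_t_in_L[of g] commutator_mem_iff[OF L_normal, of t g] by simp

text \<open>Since \<open>t\<close> is central modulo \<open>L\<close>, commutators of words in \<open>a\<close> and \<open>c\<close> are powers of \<open>t\<close> modulo
  \<open>L\<close>. These two are, for suitable \<open>n\<close>, the sections of \<open>[c c\<^sub>i\<^sup>-\<^sup>1, c]\<close> at \<open>0\<close> and at \<open>i\<close>, where \<open>c\<^sub>i\<close> is a shift of \<open>c\<close>.\<close>

lemma q_commutators:
  "q (commutator G (c \<otimes> inv (a [^] n)) c) = q t [^]\<^bsub>G Mod L\<^esub> n"
  "q (commutator G (a [^] n \<otimes> inv c) (a [^] n)) = q t [^]\<^bsub>G Mod L\<^esub> (- n)" for n :: int
proof -
  interpret q: group_hom G "G Mod L" q by (rule q_hom)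
  note [simp del] = mult_FactGroup one_FactGroup
  let ?Q = "G Mod L"
  define A C T where "A = q a" and "C = q c" and "T = q t"
  have cl: "A \<in> carrier ?Q" "C \<in> carrier ?Q" "T \<in> carrier ?Q"
    by (simp_all add: A_def C_def T_def)
  have T: "commutator ?Q C A = T"
    by (simp add: A_def C_def T_def t_def commutator_def)
  have comm: "T \<otimes>\<^bsub>?Q\<^esub> A = A \<otimes>\<^bsub>?Q\<^esub> T" "T \<otimes>\<^bsub>?Q\<^esub> C = C \<otimes>\<^bsub>?Q\<^esub> T"
    unfolding A_def C_def T_def by (simp_all add: q_t_central)
  have move: "C \<otimes>\<^bsub>?Q\<^esub> A [^]\<^bsub>?Q\<^esub> m = T [^]\<^bsub>?Q\<^esub> m \<otimes>\<^bsub>?Q\<^esub> A [^]\<^bsub>?Q\<^esub> m \<otimes>\<^bsub>?Q\<^esub> C" for m :: int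
    using cl T comm by (intro q.H.commutator_central_int_pow)
  define X where "X = A [^]\<^bsub>?Q\<^esub> n"
  define Y where "Y = T [^]\<^bsub>?Q\<^esub> n"
  have cl': "X \<in> carrier ?Q" "Y \<in> carrier ?Q"
    using cl by (simp_all add: X_def Y_def)
  have YC: "C \<otimes>\<^bsub>?Q\<^esub> Y = Y \<otimes>\<^bsub>?Q\<^esub> C" and YX: "X \<otimes>\<^bsub>?Q\<^esub> Y = Y \<otimes>\<^bsub>?Q\<^esub> X"
  proof -
    have Y: "Y \<in> {y \<in> carrier ?Q. g \<otimes>\<^bsub>?Q\<^esub> y = y \<otimes>\<^bsub>?Q\<^esub> g}"
      if "g \<in> carrier ?Q" "g \<otimes>\<^bsub>?Q\<^esub> T = T \<otimes>\<^bsub>?Q\<^esub> g" for g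
      unfolding Y_def by (rule q.H.subgroup_int_pow_closed[OF q.H.centralizer_subgroup])
        (use that cl in auto)
    have "Y \<in> {y \<in> carrier ?Q. A \<otimes>\<^bsub>?Q\<^esub> y = y \<otimes>\<^bsub>?Q\<^esub> A}"
      by (rule Y) (use cl comm in auto)
    then have "A \<in> {y \<in> carrier ?Q. Y \<otimes>\<^bsub>?Q\<^esub> y = y \<otimes>\<^bsub>?Q\<^esub> Y}"
      using cl by auto
    from q.H.subgroup_int_pow_closed[OF q.H.centralizer_subgroup[OF cl'(2)] this, of n]
    show "X \<otimes>\<^bsub>?Q\<^esub> Y = Y \<otimes>\<^bsub>?Q\<^esub> X" by (simp add: X_def)
    show "C \<otimes>\<^bsub>?Q\<^esub> Y = Y \<otimes>\<^bsub>?Q\<^esub> C"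
      using Y[of C] cl comm by auto
  qed
  \<comment> \<open>With \<open>Y\<close> central, this relation reduces both commutators to powers of \<open>T\<close>.\<close>
  have CX: "C \<otimes>\<^bsub>?Q\<^esub> X = Y \<otimes>\<^bsub>?Q\<^esub> (X \<otimes>\<^bsub>?Q\<^esub> C)"
    using move[of n] cl cl' by (simp add: X_def Y_def q.H.m_assoc)
  have "q (commutator G (c \<otimes> inv (a [^] n)) c) = commutator ?Q (C \<otimes>\<^bsub>?Q\<^esub> inv\<^bsub>?Q\<^esub> X) C"
    by (simp add: commutator_def C_def X_def A_def q.hom_int_pow)
  also have "\<dots> = C \<otimes>\<^bsub>?Q\<^esub> inv\<^bsub>?Q\<^esub> X \<otimes>\<^bsub>?Q\<^esub> (C \<otimes>\<^bsub>?Q\<^esub> X) \<otimes>\<^bsub>?Q\<^esub> inv\<^bsub>?Q\<^esub> C \<otimes>\<^bsub>?Q\<^esub> inv\<^bsub>?Q\<^esub> C"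
    using cl cl' by (simp add: commutator_def q.H.word_simps)
  also have "\<dots> = C \<otimes>\<^bsub>?Q\<^esub> inv\<^bsub>?Q\<^esub> X \<otimes>\<^bsub>?Q\<^esub> (X \<otimes>\<^bsub>?Q\<^esub> Y) \<otimes>\<^bsub>?Q\<^esub> inv\<^bsub>?Q\<^esub> C"
    unfolding CX YX using cl cl' by (simp add: q.H.word_simps)
  also have "\<dots> = (C \<otimes>\<^bsub>?Q\<^esub> Y) \<otimes>\<^bsub>?Q\<^esub> inv\<^bsub>?Q\<^esub> C"
    using cl cl' by (simp add: q.H.word_simps)
  also have "\<dots> = Y"
    unfolding YC using cl cl' by (simp add: q.H.word_simps)
  finally show "q (commutator G (c \<otimes> inv (a [^] n)) c) = q t [^]\<^bsub>?Q\<^esub> n"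
    by (simp add: Y_def T_def)
  have "q (commutator G (a [^] n \<otimes> inv c) (a [^] n)) = commutator ?Q (X \<otimes>\<^bsub>?Q\<^esub> inv\<^bsub>?Q\<^esub> C) X"
    by (simp add: commutator_def C_def X_def A_def q.hom_int_pow)
  also have "\<dots> = X \<otimes>\<^bsub>?Q\<^esub> (inv\<^bsub>?Q\<^esub> C \<otimes>\<^bsub>?Q\<^esub> X \<otimes>\<^bsub>?Q\<^esub> C) \<otimes>\<^bsub>?Q\<^esub> inv\<^bsub>?Q\<^esub> X \<otimes>\<^bsub>?Q\<^esub> inv\<^bsub>?Q\<^esub> X"
    using cl cl' by (simp add: commutator_def q.H.word_simps)
  also have "inv\<^bsub>?Q\<^esub> C \<otimes>\<^bsub>?Q\<^esub> X \<otimes>\<^bsub>?Q\<^esub> C = inv\<^bsub>?Q\<^esub> Y \<otimes>\<^bsub>?Q\<^esub> X"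
  proof -
    have "C \<otimes>\<^bsub>?Q\<^esub> (inv\<^bsub>?Q\<^esub> Y \<otimes>\<^bsub>?Q\<^esub> X) = inv\<^bsub>?Q\<^esub> Y \<otimes>\<^bsub>?Q\<^esub> (Y \<otimes>\<^bsub>?Q\<^esub> C) \<otimes>\<^bsub>?Q\<^esub> inv\<^bsub>?Q\<^esub> Y \<otimes>\<^bsub>?Q\<^esub> X"
      using cl cl' by (simp add: q.H.word_simps)
    also have "\<dots> = inv\<^bsub>?Q\<^esub> Y \<otimes>\<^bsub>?Q\<^esub> (C \<otimes>\<^bsub>?Q\<^esub> X)"
      unfolding YC[symmetric] using cl cl' by (simp add: q.H.word_simps)
    also have "\<dots> = X \<otimes>\<^bsub>?Q\<^esub> C"
      unfolding CX using cl cl' by (simp add: q.H.word_simps)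
    finally have "inv\<^bsub>?Q\<^esub> C \<otimes>\<^bsub>?Q\<^esub> (C \<otimes>\<^bsub>?Q\<^esub> (inv\<^bsub>?Q\<^esub> Y \<otimes>\<^bsub>?Q\<^esub> X)) = inv\<^bsub>?Q\<^esub> C \<otimes>\<^bsub>?Q\<^esub> (X \<otimes>\<^bsub>?Q\<^esub> C)"
      by simp
    then show ?thesis
      using cl cl' by (simp add: q.H.word_simps)
  qed
  also have "X \<otimes>\<^bsub>?Q\<^esub> (inv\<^bsub>?Q\<^esub> Y \<otimes>\<^bsub>?Q\<^esub> X) \<otimes>\<^bsub>?Q\<^esub> inv\<^bsub>?Q\<^esub> X \<otimes>\<^bsub>?Q\<^esub> inv\<^bsub>?Q\<^esub> X
      = inv\<^bsub>?Q\<^esub> Y \<otimes>\<^bsub>?Q\<^esub> (Y \<otimes>\<^bsub>?Q\<^esub> X) \<otimes>\<^bsub>?Q\<^esub> inv\<^bsub>?Q\<^esub> Y \<otimes>\<^bsub>?Q\<^esub> inv\<^bsub>?Q\<^esub> X"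
    using cl cl' by (simp add: q.H.word_simps)
  also have "\<dots> = inv\<^bsub>?Q\<^esub> Y"
    unfolding YX[symmetric] using cl cl' by (simp add: q.H.word_simps)
  finally show "q (commutator G (a [^] n \<otimes> inv c) (a [^] n)) = q t [^]\<^bsub>?Q\<^esub> (- n)"
    using cl by (simp add: Y_def T_def q.H.int_pow_neg)
qed

text \<open>Away from \<open>0\<close> and \<open>i\<close> all sections of \<open>[c c\<^sub>i\<^sup>-\<^sup>1, c]\<close> are commutators of powers of \<open>a\<close>.\<close>

lemma realized_first:
  assumes i: "\<not> int p dvd i"
  shows "realized (\<lambda>k. \<beta> (- i) * of_bool (int p dvd k) - \<beta> i * of_bool (int p dvd k - i))"
  unfolding realized_def
proof (intro bexI allI)
  interpret q: group_hom G "G Mod L" q by (rule q_hom)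
  let ?d = "commutator G (c \<otimes> inv (shift c i)) c"
  show "?d \<in> \<gamma>\<^sub>3"
    using shift_quotient_in_derived[of c 0 i] by (intro commutator_in_third) auto
  fix k
  have sec_d: "sec ?d k = commutator G (sec c k \<otimes> inv (sec c (k - i))) (sec c k)"
    using c_in_S by (simp add: sec_commutator sec_mult sec_inv sec_shift)
  consider "int p dvd k" "\<not> int p dvd k - i" | "int p dvd k - i" "\<not> int p dvd k"
    | "\<not> int p dvd k" "\<not> int p dvd k - i"
    using i dvd_diff[of "int p" k "k - i"] by fastforce
  then show "q (sec ?d k) = q t [^]\<^bsub>G Mod L\<^esub>
      (\<beta> (- i) * of_bool (int p dvd k) - \<beta> i * of_bool (int p dvd k - i))"
  proof cases
    case 1
    have "\<beta> (k - i) = \<beta> (- i)"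
      using 1 by (intro \<beta>_cong dvd_imp_cong) simp
    then show ?thesis
      unfolding sec_d using 1 q_commutators(1) by (simp add: sec_c)
  next
    case 2
    have "\<beta> k = \<beta> i"
      using 2 by (intro \<beta>_cong dvd_imp_cong)
    then show ?thesis
      unfolding sec_d using 2 q_commutators(2)[of "\<beta> i"] by (simp add: sec_c)
  next
    case 3
    then show ?thesis
      unfolding sec_d using a_pow_comm[of "\<beta> k - \<beta> (k - i)" "\<beta> k"]
      by (simp add: sec_c int_pow_diff)
  qed
qed

text \<open>In the group ring, the hypothesis is about \<open>v - u X\<close> where \<open>X\<close> is the translation by \<open>i\<close>, and
  \<open>v - u X\<close> divides \<open>v ^ m - (u X) ^ m\<close>. For \<open>m = p\<close> this is the constant \<open>v ^ p - u ^ p\<close>.\<close>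

lemma realized_powers:
  assumes "realized (\<lambda>k. v * of_bool (int p dvd k) - u * of_bool (int p dvd k - i))"
  shows "realized (\<lambda>k. v ^ m * of_bool (int p dvd k) - u ^ m * of_bool (int p dvd k - int m * i))"
    (is "realized (?f m)")
proof (induction m)
  case 0
  interpret N: normal \<gamma>\<^sub>3 G by (rule third_normal)
  show ?case unfolding realized_def by (intro bexI[of _ "\<one>"]) (simp_all add: group_hom.hom_one[OF q_hom])
next
  case (Suc m)
  have "realized (\<lambda>k. v * ?f m k + u ^ m * (v * of_bool (int p dvd (k - int m * i))
      - u * of_bool (int p dvd (k - int m * i) - i)))"
    using realized_shift[OF assms, of "int m * i"] by (intro realized_add realized_scale Suc)
  also have "(\<lambda>k. v * ?f m k + u ^ m * (v * of_bool (int p dvd (k - int m * i))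
      - u * of_bool (int p dvd (k - int m * i) - i))) = ?f (Suc m)"
    by (intro ext) (simp add: algebra_simps)
  finally show ?case .
qed

text \<open>The \<open>p\<close>-th power of \<open>t\<close> is in \<open>L\<close> because \<open>a\<close> has order \<open>p\<close>. By Fermat's theorem the exponent
  \<open>v ^ p - u ^ p\<close> is congruent to \<open>v - u\<close>, which is not divisible by \<open>p\<close>.\<close>

lemma t_in_L: "t \<in> L"
proof -
  interpret q: group_hom G "G Mod L" q by (rule q_hom)
  interpret N: normal \<gamma>\<^sub>3 G by (rule third_normal)
  obtain i where i: "\<not> int p dvd i" "\<not> int p dvd \<beta> (- i)" "\<not> int p dvd \<beta> (- i) - \<beta> i"
    by (rule asymmetric_index)
  define v u where "v = \<beta> (- i)" and "u = \<beta> i"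
  have "realized (\<lambda>k. v ^ p * of_bool (int p dvd k) - u ^ p * of_bool (int p dvd k - int p * i))"
    unfolding v_def u_def by (intro realized_powers realized_first i)
  then obtain d where d: "d \<in> \<gamma>\<^sub>3"
    "\<And>k. q (sec d k) = q t [^]\<^bsub>G Mod L\<^esub> ((v ^ p - u ^ p) * of_bool (int p dvd k))"
    by (auto simp: realized_def left_diff_distrib dvd_diff_left_iff)
  have dS: "d \<in> S" using d third_subset_S by auto
  have d_L: "sec d k \<in> L" if "\<not> int p dvd k" for k
    using d(2)[of k] that dS mem_normal_iff[OF L_normal, of "sec d k"] by simp
  \<comment> \<open>The sections of \<open>d\<close> away from \<open>0\<close> are only known to be in \<open>L\<close>; \<open>e\<close> corrects them to \<open>\<one>\<close>.\<close>
  have "\<exists>e\<in>\<gamma>\<^sub>3 \<inter> S. \<forall>k. sec e k = (if int p dvd k then \<one> else sec d k)"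
  proof (rule rigid_fill[OF third_normal])
    show "(if int p dvd k then \<one> else sec d k) \<in> rigid \<gamma>\<^sub>3 nonzero" for k
      using d_L[of k] subgroup.one_closed[OF rigid_subgroup[OF N.is_subgroup]] by (simp add: L_def)
  qed (simp add: sec_mod dvd_mod_iff)
  then obtain e where e: "e \<in> \<gamma>\<^sub>3" "e \<in> S" "\<And>k. sec e k = (if int p dvd k then \<one> else sec d k)"
    by blast
  have "sec d 0 \<in> L"
    unfolding L_def using d e dS
    by (intro rigidI[of "d \<otimes> inv e"]) (auto simp: sec_mult sec_inv)
  then have "q t [^]\<^bsub>G Mod L\<^esub> (v ^ p - u ^ p) = \<one>\<^bsub>G Mod L\<^esub>"
    using d(2)[of 0] dS mem_normal_iff[OF L_normal, of "sec d 0"] by simp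
  then have "q (t [^] (v ^ p - u ^ p)) = \<one>\<^bsub>G Mod L\<^esub>"
    by (simp add: q.hom_int_pow)
  then have e1: "t [^] (v ^ p - u ^ p) \<in> L"
    by (simp add: mem_normal_iff[OF L_normal])
  have "q (commutator G (a [^] int p \<otimes> inv c) (a [^] int p)) = q t [^]\<^bsub>G Mod L\<^esub> (- int p)"
    by (rule q_commutators)
  then have "q (t [^] (- int p)) = \<one>\<^bsub>G Mod L\<^esub>"
    using a_pow_eq_one[of "int p"] q.hom_one by (simp add: q.hom_int_pow del: one_FactGroup)
  then have e2: "t [^] (- int p) \<in> L"
    by (simp add: mem_normal_iff[OF L_normal])
  have "\<not> int p dvd v ^ p - u ^ p"
  proof
    assume "int p dvd v ^ p - u ^ p"
    then have "int p dvd (v ^ p - u ^ p) - (v ^ p - v) + (u ^ p - u)"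
      using fermat_int[OF p_prime] by (intro dvd_add[OF dvd_diff])
    also have "(v ^ p - u ^ p) - (v ^ p - v) + (u ^ p - u) = v - u" by simp
    finally show False using i by (simp add: v_def u_def)
  qed
  then have "coprime (v ^ p - u ^ p) (- int p)"
    using coprime_p by simp
  then show ?thesis
    using mem_subgroup_if_coprime_pow[OF normal_imp_subgroup[OF L_normal] t_closed e1 e2] by blast
qed

text \<open>The generators \<open>a\<close>, \<open>c\<close> and \<open>z\<close> commute modulo \<open>L\<close>.\<close>

theorem derived_subset_L: "G' \<subseteq> L"
proof (rule derived_subset_if_generators_commute[OF L_normal])
  show "{a, c, z} \<subseteq> carrier G" by simp
  have "c \<otimes> z \<in> generate G {a, c, z}"
    by (intro generate.eng generate.incl) auto
  moreover have "c \<otimes> z = b" by (simp add: z_def word_simps)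
  ultimately have "{a, b, c} \<subseteq> generate G {a, c, z}"
    by (auto intro: generate.incl)
  then have "carrier G \<subseteq> generate G {a, c, z}"
    using generate_subgroup_incl[OF _ generate_is_subgroup[of "{a, c, z}"], of "{a, b, c}"] generators
    by simp
  then show "generate G {a, c, z} = carrier G"
    using generate_incl[of "{a, c, z}"] by auto
  have one: "\<one> \<in> L" using L_normal normal_imp_subgroup subgroup.one_closed by blast
  fix x y assume xy: "x \<in> {a, c, z}" "y \<in> {a, c, z}"
  then have cl: "x \<in> carrier G" "y \<in> carrier G" by auto
  consider "x = y" | "y = z" | "x = z" | "x = c" "y = a" | "x = a" "y = c"
    using xy by blast
  then show "commutator G x y \<in> L"
  proof cases
    case 1
    then have "commutator G x y = \<one>"
      using cl by (subst commutator_eq_one_iff) auto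
    then show ?thesis using one by simp
  next
    case 3
    then show ?thesis
      using commutator_z_in_L[of y] cl commutator_mem_commute[OF L_normal] by blast
  next
    case 5
    then show ?thesis
      using t_in_L commutator_mem_commute[OF L_normal] by (simp add: t_def)
  qed (use cl commutator_z_in_L t_in_L in \<open>auto simp: t_def\<close>)
qed

end

section \<open>Finite groups of prime power order\<close>

text \<open>By Sylow's theorem a prime divisor \<open>r\<close> of the order yields a nontrivial element whose \<open>r\<close>-th
  power is \<open>\<one>\<close>. Some \<open>p ^ n\<close>-th power of it is \<open>\<one>\<close> as well, so \<open>r = p\<close>.\<close>

lemma (in group) order_prime_power:
  assumes fin: "finite (carrier G)" and p: "prime p"
    and pow: "\<And>x. x \<in> carrier G \<Longrightarrow> \<exists>n. x [^] (p ^ n :: nat) = \<one>"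
  shows "\<exists>k. order G = p ^ k"
proof -
  have only_p: "r = p" if r: "prime r" "r dvd order G" for r
  proof (rule ccontr)
    assume "r \<noteq> p"
    obtain m where m: "order G = r ^ 1 * m" using r(2) by (auto elim: dvdE)
    have "\<exists>K. subgroup K G \<and> card K = r ^ 1"
      by (rule sylow_thm[OF r(1) is_group m fin])
    then obtain K where K: "subgroup K G" "card K = r" by auto
    have "K \<noteq> {\<one>}" using K(2) prime_gt_1_nat[OF r(1)] by auto
    then obtain x where x: "x \<in> K" "x \<noteq> \<one>"
      using subgroup.one_closed[OF K(1)] by blast
    then have xc: "x \<in> carrier G" by (intro subgroup.mem_carrier[OF K(1)])
    interpret K: group "G\<lparr>carrier := K\<rparr>" by (rule subgroup_imp_group[OF K(1)])
    have "x [^] r = \<one>"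
      using K.pow_order_eq_1[of x] x K by (simp add: order_def nat_pow_consistent[symmetric])
    moreover obtain n where "x [^] (p ^ n) = \<one>" using pow[OF xc] by blast
    moreover have "coprime (int r) (int (p ^ n))"
      using r(1) p \<open>r \<noteq> p\<close> by (simp add: primes_coprime)
    ultimately have "x \<in> {\<one>}"
      using mem_subgroup_if_coprime_pow[OF triv_subgroup xc, of "int r" "int (p ^ n)"]
      by (simp only: int_pow_int) blast
    then show False using x by simp
  qed
  have "order G \<noteq> 0" using fin order_gt_0_iff_finite by simp
  moreover have "\<not> is_unit p" using p not_prime_1 by auto
  ultimately obtain m where m: "order G = p ^ multiplicity p (order G) * m" "\<not> p dvd m"
    using multiplicity_decompose' by metis
  have "m = 1"
  proof (rule ccontr)
    assume "m \<noteq> 1"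
    then obtain r where r: "prime r" "r dvd m" using prime_factor_nat by blast
    then have "r dvd order G" using m(1) by (metis dvd_mult)
    with r m(2) only_p show False by blast
  qed
  with m(1) show ?thesis by auto
qed

section \<open>The level subgroups and the normal subgroups of finite index\<close>

lemma finite_image_if_determined:
  assumes "finite (f ` A)" "\<And>x y. x \<in> A \<Longrightarrow> y \<in> A \<Longrightarrow> f x = f y \<Longrightarrow> g x = g y"
  shows "finite (g ` A)"
proof -
  have "g x = g (inv_into A f (f x))" if "x \<in> A" for x
    using assms(2) that by (metis f_inv_into_f imageI inv_into_into)
  then have "g ` A \<subseteq> (\<lambda>y. g (inv_into A f y)) ` f ` A"
    by (auto simp: image_iff)
  then show ?thesis
    using assms(1) finite_surj by blast
qed

lemma (in group) rcos_eq_iff: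
  assumes "subgroup H G" "x \<in> carrier G" "y \<in> carrier G"
  shows "H #> x = H #> y \<longleftrightarrow> x \<otimes> inv y \<in> H"
proof
  assume "H #> x = H #> y"
  then have "x \<in> H #> y" using rcos_self[OF assms(2,1)] by simp
  then show "x \<otimes> inv y \<in> H"
    using subgroup.rcos_module[OF assms(1) is_group assms(3,2)] by blast
next
  assume "x \<otimes> inv y \<in> H"
  then have "x \<in> H #> y"
    using subgroup.rcos_module[OF assms(1) is_group assms(3,2)] by blast
  then show "H #> x = H #> y"
    using repr_independence[OF _ assms(3,1)] by simp
qed

context egs_sections
begin

text \<open>\<open>H n\<close> consists of the elements that fix the level \<open>n\<close> of the tree and have all their sections there
  in the commutator subgroup, and \<open>St n\<close> is the stabilizer of that level.\<close>

primrec H :: "nat \<Rightarrow> 'a set" where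
  "H 0 = G'"
| "H (Suc n) = {h \<in> S. \<forall>k. sec h k \<in> H n}"

primrec St :: "nat \<Rightarrow> 'a set" where
  "St 0 = carrier G"
| "St (Suc n) = {g \<in> S. \<forall>k. sec g k \<in> St n}"

lemma G'_insert:
  assumes "x \<in> G'"
  obtains d where "d \<in> \<gamma>\<^sub>3" "d \<in> G'" "d \<in> S" "sec d 0 = x" "\<And>k. \<not> int p dvd k \<Longrightarrow> sec d k = \<one>"
proof -
  have "x \<in> rigid \<gamma>\<^sub>3 nonzero" using assms derived_subset_L by (auto simp: L_def)
  then show thesis
    by (rule rigidE) (use that third_subset_derived in auto)
qed

lemma G'_fill:
  assumes "\<And>k. x k \<in> G'" "\<And>k. x (k mod int p) = x k"
  shows "\<exists>d\<in>\<gamma>\<^sub>3 \<inter> S. \<forall>k. sec d k = x k"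
  using assms derived_subset_L by (intro rigid_fill third_normal) (auto simp: L_def)

lemma decompose:
  assumes "g \<in> carrier G"
  obtains i :: int and s where "s \<in> S" "g = a [^] i \<otimes> s"
proof -
  let ?T = "{g. \<exists>i::int. \<exists>s\<in>S. g = a [^] i \<otimes> s}"
  have T: "subgroup ?T G"
  proof (rule subgroupI)
    show "?T \<subseteq> carrier G" by auto
    have "a [^] (0 :: int) \<otimes> \<one> \<in> ?T" using S.one_closed by blast
    then show "?T \<noteq> {}" by (metis empty_iff)
  next
    fix g assume "g \<in> ?T"
    then obtain i :: int and s where s: "s \<in> S" "g = a [^] i \<otimes> s" by blast
    have "inv g = a [^] (- i) \<otimes> (a [^] i \<otimes> inv s \<otimes> inv (a [^] i))"
      using s by (simp add: word_simps int_pow_neg)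
    moreover have "a [^] i \<otimes> inv s \<otimes> inv (a [^] i) \<in> S"
      using s by (intro S_conj) auto
    ultimately show "inv g \<in> ?T" by blast
  next
    fix g h assume "g \<in> ?T" "h \<in> ?T"
    then obtain i j :: int and s r where s: "s \<in> S" "g = a [^] i \<otimes> s" "r \<in> S" "h = a [^] j \<otimes> r" by blast
    have "g \<otimes> h = a [^] (i + j) \<otimes> (shift s j \<otimes> r)"
      using s by (simp add: shift_def word_simps int_pow_mult)
    moreover have "shift s j \<otimes> r \<in> S"
      using s by auto
    ultimately show "g \<otimes> h \<in> ?T" by blast
  qed
  have "a = a [^] (1::int) \<otimes> \<one>" "b = a [^] (0::int) \<otimes> b" "c = a [^] (0::int) \<otimes> c"
    by simp_all
  then have "{a, b, c} \<subseteq> ?T"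
    using b_in_S c_in_S S.one_closed by blast
  from generate_subgroup_incl[OF this T] have "g \<in> ?T"
    using assms generators by auto
  then show thesis using that by blast
qed

lemma conj_decomposed:
  assumes "s \<in> carrier G" "h \<in> carrier G"
  shows "(a [^] i \<otimes> s) \<otimes> h \<otimes> inv (a [^] i \<otimes> s) = shift (s \<otimes> h \<otimes> inv s) (- i)"
  using assms by (simp add: shift_def word_simps int_pow_neg)

lemma H_normal: "H n \<lhd> G"
proof (induction n)
  case 0
  show ?case by (simp add: derived_carrier_normal)
next
  case (Suc n)
  interpret N: normal "H n" G by fact
  show ?case
    unfolding normal_inv_iff
  proof (intro conjI ballI)
    show "subgroup (H (Suc n)) G"
      by (rule subgroupI) (auto simp: sec_mult sec_inv intro!: exI[of _ "\<one>"])
    fix g h assume "g \<in> carrier G" and h: "h \<in> H (Suc n)"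
    then obtain i s where s: "s \<in> S" "g = a [^] (i :: int) \<otimes> s"
      by (elim decompose)
    have "sec (shift (s \<otimes> h \<otimes> inv s) (- i)) k \<in> H n" for k
      using s h by (simp add: sec_shift S_conj sec_conj N.inv_op_closed2)
    then show "g \<otimes> h \<otimes> inv g \<in> H (Suc n)"
      using s h by (simp add: conj_decomposed S_conj)
  qed
qed

text \<open>An element of \<open>\<gamma>\<^sub>3\<close> with the same sections exists, and sections determine an element.\<close>

lemma H_1_subset: "H (Suc 0) \<subseteq> \<gamma>\<^sub>3"
proof
  fix h assume h: "h \<in> H (Suc 0)"
  then obtain d where "d \<in> \<gamma>\<^sub>3" "d \<in> S" "\<forall>k. sec d k = sec h k"
    using G'_fill[of "sec h"] by (auto simp: sec_mod)
  then have "h = d" using h by - (rule sec_eqI, simp_all)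
  then show "h \<in> \<gamma>\<^sub>3" using \<open>d \<in> \<gamma>\<^sub>3\<close> by simp
qed

lemma H_decreasing: "H (Suc n) \<subseteq> H n"
proof (induction n)
  case 0
  show ?case using H_1_subset third_subset_derived by auto
qed auto

lemma H_Suc_subset:
  assumes "N \<lhd> G" "H n \<subseteq> rigid N nonzero"
  shows "H (Suc n) \<subseteq> N"
proof
  fix h assume h: "h \<in> H (Suc n)"
  then have "\<exists>d\<in>N \<inter> S. \<forall>k. sec d k = sec h k"
    using assms by (intro rigid_fill) (auto simp: sec_mod)
  then obtain d where "d \<in> N" "d \<in> S" "\<forall>k. sec d k = sec h k" by blast
  then have "h = d" using h by - (rule sec_eqI, simp_all)
  then show "h \<in> N" using \<open>d \<in> N\<close> by simp
qed

lemma commutator_shift: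
  "x \<in> carrier G \<Longrightarrow> y \<in> carrier G \<Longrightarrow> shift (commutator G x y) i = commutator G (shift x i) (shift y i)"
  using commutator_conj[of x y "inv (a [^] i)"] by (simp add: shift_def)

text \<open>An element \<open>g\<close> outside \<open>S\<close> moves the subtree below \<open>0\<close> off itself, so the commutator of \<open>g\<close> with
  an automorphism \<open>X\<close> supported there agrees with the inverse of \<open>X\<close> below \<open>0\<close>; a second
  commutator, with an automorphism \<open>Y\<close> supported there, cuts off what the first one does elsewhere.\<close>

lemma normal_contains_level_outside:
  assumes N: "N \<lhd> G" and g: "g \<in> carrier G" "g \<notin> S"
    and comm: "\<And>x. x \<in> G' \<Longrightarrow> commutator G g x \<in> N"
  shows "H 3 \<subseteq> N"
proof -
  interpret D: normal G' G by (rule derived_carrier_normal)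
  define N1 where "N1 = rigid N nonzero"
  define N2 where "N2 = rigid N1 nonzero"
  have nor: "N1 \<lhd> G" "N2 \<lhd> G"
    unfolding N1_def N2_def by (intro rigid_normal N)+
  obtain j s where s: "s \<in> S" "g = a [^] (j :: int) \<otimes> s"
    using g by (elim decompose)
  have j: "\<not> int p dvd j"
    using s g a_pow_eq_one[of j] by auto
  have "commutator G x\<^sub>1 h \<in> N2" if x\<^sub>1: "x\<^sub>1 \<in> G'" and h: "h \<in> carrier G" for x\<^sub>1 h
  proof -
    obtain x where x: "x \<in> G'" "x \<in> S" "sec x 0 = inv x\<^sub>1" "\<And>k. \<not> int p dvd k \<Longrightarrow> sec x k = \<one>"
      using D.m_inv_closed[OF x\<^sub>1] by (rule G'_insert) blast
    \<comment> \<open>\<open>X\<close> acts two levels down, so that \<open>Y\<close> may have an arbitrary \<open>h\<close> as its section there.\<close>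
    obtain X where X: "X \<in> G'" "X \<in> S" "sec X 0 = x" "\<And>k. \<not> int p dvd k \<Longrightarrow> sec X k = \<one>"
      using x(1) by (rule G'_insert) blast
    obtain y where y: "y \<in> G'" "y \<in> S" "sec y 0 = h"
      using h rigid_derived_empty by (blast elim: rigidE)
    obtain Y where Y: "Y \<in> G'" "Y \<in> S" "sec Y 0 = y" "\<And>k. \<not> int p dvd k \<Longrightarrow> sec Y k = \<one>"
      using y(1) by (rule G'_insert) blast
    let ?D = "commutator G g X"
    have D_eq: "?D = shift (s \<otimes> X \<otimes> inv s) (- j) \<otimes> inv X"
      using conj_decomposed[of s X j] s X by (simp add: commutator_def)
    have DS: "?D \<in> S"
      unfolding D_eq using s X by (simp add: S_conj)
    have D0: "sec ?D 0 = inv x"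
      unfolding D_eq using s x(2) X j by (simp add: sec_mult sec_inv S_conj sec_shift sec_conj)
    have "commutator G ?D Y \<in> N"
      using comm X Y g by (intro commutator_in_normal[OF N]) auto
    moreover have "sec (commutator G ?D Y) k = \<one>" if "\<not> int p dvd k" for k
      using DS Y that by (simp add: sec_commutator)
    moreover have "sec (commutator G ?D Y) 0 = commutator G (inv x) y"
      using DS D0 Y by (simp add: sec_commutator)
    ultimately have "commutator G (inv x) y \<in> N1"
      unfolding N1_def using DS Y by (intro rigidI[of "commutator G ?D Y"]) auto
    moreover have "sec (commutator G (inv x) y) 0 = commutator G x\<^sub>1 h"
      using x y x\<^sub>1 by (simp add: sec_commutator sec_inv)
    moreover have "sec (commutator G (inv x) y) k = \<one>" if "\<not> int p dvd k" for k
      using x y that by (simp add: sec_commutator sec_inv)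
    ultimately show ?thesis
      unfolding N2_def using x y by (intro rigidI[of "commutator G (inv x) y"]) auto
  qed
  then have "\<gamma>\<^sub>3 \<subseteq> N2"
    using nor normal_imp_subgroup by (intro third_lower_central_subset) auto
  then have "H 1 \<subseteq> N2" using H_1_subset by auto
  then have "H 2 \<subseteq> N1" using H_Suc_subset[OF nor(1), of 1] by (simp add: N2_def numeral_2_eq_2)
  then show ?thesis using H_Suc_subset[OF N, of 2] by (simp add: N1_def numeral_3_eq_3)
qed

text \<open>By induction on the level that \<open>g\<close> moves. The hypothesis on commutators is weaker than \<open>g \<in> N\<close>; unlike
  the latter, it passes from \<open>g\<close> and \<open>N\<close> to a section of \<open>g\<close> and \<open>rigid N nonzero\<close>, because
  \<open>g\<close> can be commuted with elements that act below one vertex only.\<close>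

lemma normal_contains_level:
  assumes "N \<lhd> G" "g \<in> carrier G" "g \<notin> St n" "\<And>x. x \<in> G' \<Longrightarrow> commutator G g x \<in> N"
  shows "\<exists>m. H m \<subseteq> N"
  using assms
proof (induction n arbitrary: g N)
  case 0
  then show ?case by simp
next
  case (Suc n)
  show ?case
  proof (cases "g \<in> S")
    case False
    then show ?thesis using normal_contains_level_outside Suc.prems by blast
  next
    case True
    then obtain k where k: "sec g k \<notin> St n" using Suc.prems by auto
    define f where "f = shift g (- k)"
    have f: "f \<in> S" "sec f 0 \<notin> St n"
      using True k by (auto simp: f_def sec_shift)
    have f_comm: "commutator G f x \<in> N" if "x \<in> G'" for x
    proof -
      have xc: "x \<in> carrier G" using that derived_carrier_subset by blast
      have "commutator G g (shift x k) \<in> N"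
        using that by (intro Suc.prems shift_in_normal[OF derived_carrier_normal])
      from shift_in_normal[OF Suc.prems(1) this, of "- k"] show ?thesis
        using xc True by (simp add: commutator_shift shift_shift f_def)
    qed
    have "commutator G (sec f 0) x \<in> rigid N nonzero" if x: "x \<in> G'" for x
    proof -
      obtain d where d: "d \<in> G'" "d \<in> S" "sec d 0 = x" "\<And>k. \<not> int p dvd k \<Longrightarrow> sec d k = \<one>"
        using x by (rule G'_insert) blast
      then show ?thesis
        using f f_comm by (intro rigidI[of "commutator G f d"]) (auto simp: sec_commutator)
    qed
    then obtain m where "H m \<subseteq> rigid N nonzero"
      using Suc.IH[of "rigid N nonzero" "sec f 0"] f rigid_normal[OF Suc.prems(1)] by auto
    then show ?thesis using H_Suc_subset[OF Suc.prems(1)] by blast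
  qed
qed

text \<open>Sections at \<open>0\<close> map the proper subgroup \<open>S\<close> onto the whole group.\<close>

lemma carrier_infinite: "infinite (carrier G)"
proof
  assume fin: "finite (carrier G)"
  have "rigid (carrier G) {} \<subseteq> (\<lambda>s. sec s 0) ` S"
    by (auto simp: rigid_def)
  then have "carrier G \<subseteq> (\<lambda>s. sec s 0) ` S"
    by (simp only: rigid_carrier_empty)
  then have "card (carrier G) \<le> card S"
    using fin S.subset by (meson card_image_le card_mono finite_imageI finite_subset le_trans)
  moreover have "card S < card (carrier G)"
    using fin S.subset a_notin_S a_closed by (intro psubset_card_mono) auto
  ultimately show False by simp
qed

theorem finite_index_contains_level:
  assumes faithful: "\<And>g. (\<And>n. g \<in> St n) \<Longrightarrow> g = \<one>"
    and N: "N \<lhd> G" "finite (rcosets N)"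
  shows "\<exists>m. H m \<subseteq> N"
proof -
  interpret N: normal N G by fact
  have "N \<noteq> {\<one>}"
  proof
    assume "N = {\<one>}"
    then have "rcosets N = (\<lambda>x. {x}) ` carrier G"
      by (auto simp: RCOSETS_def r_coset_def)
    then show False
      using N(2) carrier_infinite finite_imageD[of "\<lambda>x. {x}" "carrier G"] by (auto simp: inj_on_def)
  qed
  then obtain g where g: "g \<in> N" "g \<noteq> \<one>" using N.one_closed by blast
  then obtain n where "g \<notin> St n" using faithful by blast
  then show ?thesis
    using g derived_carrier_subset by (intro normal_contains_level[OF N(1), of g n] commutator_in_normal N) auto
qed

lemma pow_p_in_derived:
  assumes "g \<in> carrier G"
  shows "g [^] p \<in> G'"
proof -
  interpret q: group_hom G "G Mod G'" "\<lambda>x. G' #> x"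
    by (rule mod_hom[OF derived_carrier_normal])
  interpret Q: comm_group "G Mod G'" by (rule derived_quot_is_comm_group)
  let ?K = "{x \<in> carrier (G Mod G'). x [^]\<^bsub>G Mod G'\<^esub> p = \<one>\<^bsub>G Mod G'\<^esub>}"
  have "subgroup ?K (G Mod G')"
    by (rule q.H.subgroupI)
      (auto simp: Q.nat_pow_distrib q.H.nat_pow_inv simp del: one_FactGroup mult_FactGroup)
  then have K: "subgroup {x \<in> carrier G. G' #> x \<in> ?K} G"
    by (rule q.preimage_subgroup)
  have "x [^] p = \<one> \<Longrightarrow> x \<in> carrier G \<Longrightarrow> x \<in> {x \<in> carrier G. G' #> x \<in> ?K}" for x
    using q.hom_nat_pow[of x p] q.hom_one q.hom_closed[of x] by (simp del: one_FactGroup)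
  then have "carrier G \<subseteq> {x \<in> carrier G. G' #> x \<in> ?K}"
    using generate_subgroup_incl[OF _ K, of "{a, b, c}"] generators a_order b_order c_order
    by (simp del: one_FactGroup)
  then have "G' #> (g [^] p) = \<one>\<^bsub>G Mod G'\<^esub>"
    using assms q.hom_nat_pow[of g p] by auto
  then show ?thesis
    using assms mem_normal_iff[OF derived_carrier_normal, of "g [^] p"] by simp
qed

text \<open>The \<open>p\<close>-th power of \<open>g\<close> fixes the first level, and the remaining powers are taken in each section.\<close>

lemma prime_power_in_H:
  "g \<in> carrier G \<Longrightarrow> g [^] (p ^ Suc n) \<in> H n"
proof (induction n arbitrary: g)
  case 0
  then show ?case by (simp add: pow_p_in_derived)
next
  case (Suc n)
  have gS: "g [^] p \<in> S"
    using pow_p_in_derived[OF Suc.prems] derived_subset_S by blast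
  have "g [^] (p ^ Suc (Suc n)) = (g [^] p) [^] (p ^ Suc n)"
    using Suc.prems by (simp only: nat_pow_pow power_Suc)
  moreover have "(g [^] p) [^] (p ^ Suc n) \<in> H (Suc n)"
    using gS Suc.IH[of "sec (g [^] p) k" for k] by (simp add: sec_nat_pow del: power_Suc)
  ultimately show ?case by simp
qed

text \<open>The quotient is abelian and generated by three elements of order dividing \<open>p\<close>.\<close>

lemma finite_index_derived: "finite (rcosets G')"
proof -
  interpret q: group_hom G "G Mod G'" "\<lambda>x. G' #> x"
    by (rule mod_hom[OF derived_carrier_normal])
  interpret Q: comm_group "G Mod G'" by (rule derived_quot_is_comm_group)
  note [simp del] = mult_FactGroup one_FactGroup
  let ?Q = "G Mod G'"
  define A B C where "A = G' #> a" and "B = G' #> b" and "C = G' #> c"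
  have cl: "A \<in> carrier ?Q" "B \<in> carrier ?Q" "C \<in> carrier ?Q"
    using q.hom_closed by (simp_all add: A_def B_def C_def)
  define f where "f = (\<lambda>(i :: int, j :: int, k :: int). A [^]\<^bsub>?Q\<^esub> i \<otimes>\<^bsub>?Q\<^esub> (B [^]\<^bsub>?Q\<^esub> j \<otimes>\<^bsub>?Q\<^esub> C [^]\<^bsub>?Q\<^esub> k))"
  have f_closed: "f x \<in> carrier ?Q" for x
    using cl by (auto simp: f_def split: prod.split)
  have f_mult: "f (i, j, k) \<otimes>\<^bsub>?Q\<^esub> f (i', j', k') = f (i + i', j + j', k + k')" for i j k i' j' k'
    using cl by (simp add: f_def q.H.int_pow_mult Q.m_ac)
  have f_zero: "f (0, 0, 0) = \<one>\<^bsub>?Q\<^esub>"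
    by (simp add: f_def)
  have f_inv: "inv\<^bsub>?Q\<^esub> f (i, j, k) = f (- i, - j, - k)" for i j k
    using f_mult[of "- i" "- j" "- k" i j k] f_zero f_closed by (intro q.H.inv_equality) auto
  have sub: "subgroup (range f) ?Q"
  proof (rule q.H.subgroupI)
    show "range f \<subseteq> carrier ?Q" using f_closed by auto
    show "inv\<^bsub>?Q\<^esub> x \<in> range f" if "x \<in> range f" for x
      using that f_inv by (metis (no_types, lifting) prod_cases3 rangeE rangeI)
    show "x \<otimes>\<^bsub>?Q\<^esub> y \<in> range f" if "x \<in> range f" "y \<in> range f" for x y
      using that f_mult by (metis (no_types, lifting) prod_cases3 rangeE rangeI)
  qed auto
  have "A = f (1, 0, 0)" "B = f (0, 1, 0)" "C = f (0, 0, 1)"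
    using cl by (simp_all add: f_def)
  then have ABC: "A \<in> range f" "B \<in> range f" "C \<in> range f" by auto
  have "carrier G \<subseteq> {x \<in> carrier G. G' #> x \<in> range f}"
    using generate_subgroup_incl[OF _ q.preimage_subgroup[OF sub], of "{a, b, c}"] generators ABC
    by (simp add: A_def B_def C_def)
  then have "rcosets G' \<subseteq> range f"
    by (auto simp: RCOSETS_def)
  also have "range f \<subseteq> f ` ({0..<int p} \<times> {0..<int p} \<times> {0..<int p})"
  proof
    fix x assume "x \<in> range f"
    then obtain i j k where x: "x = f (i, j, k)" by auto
    have red: "X [^]\<^bsub>?Q\<^esub> i = X [^]\<^bsub>?Q\<^esub> (i mod int p)"
      if "X = G' #> g" "g \<in> carrier G" "g [^] p = \<one>" for X g and i :: int
    proof -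
      have "g [^] i = g [^] (i mod int p)"
        using that pow_eq_one[of g "int p * (i div int p)"] int_pow_mult[of g "int p * (i div int p)" "i mod int p"]
        by simp
      then show ?thesis using that by (simp flip: q.hom_int_pow)
    qed
    have "x = f (i mod int p, j mod int p, k mod int p)"
      unfolding x f_def
      using red[OF A_def] red[OF B_def] red[OF C_def] a_order b_order c_order by simp
    then show "x \<in> f ` ({0..<int p} \<times> {0..<int p} \<times> {0..<int p})"
      using p_pos by auto
  qed
  finally show ?thesis
    by (rule finite_subset) simp
qed

text \<open>The sections embed \<open>S / H (Suc n)\<close> into a power of \<open>G / H n\<close>, and \<open>S\<close> has index at most \<open>p\<close>.\<close>

lemma finite_index_H: "finite (rcosets (H n))"
proof (induction n)
  case 0
  show ?case using finite_index_derived by simp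
next
  case (Suc n)
  interpret N: normal "H n" G by (rule H_normal)
  interpret N': normal "H (Suc n)" G by (rule H_normal)
  define F where "F s = (\<lambda>k\<in>{..<p}. H n #> sec s (int k))" for s
  have "F ` S \<subseteq> (\<Pi>\<^sub>E k\<in>{..<p}. rcosets (H n))"
    by (auto simp: F_def intro!: rcosetsI N.subset)
  then have "finite (F ` S)"
    by (rule finite_subset) (intro finite_PiE Suc finite_lessThan)
  moreover have "H (Suc n) #> s = H (Suc n) #> r" if sr: "s \<in> S" "r \<in> S" "F s = F r" for s r
  proof -
    have "sec s k \<otimes> inv (sec r k) \<in> H n" for k
    proof -
      define l where "l = nat (k mod int p)"
      have l: "l < p" "int l = k mod int p"
        using p_pos by (simp_all add: l_def nat_less_iff)
      then have "H n #> sec s (int l) = H n #> sec r (int l)"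
        using fun_cong[OF sr(3), of l] by (simp add: F_def)
      then show ?thesis
        using sr rcos_eq_iff[OF N.is_subgroup, of "sec s k" "sec r k"] by (simp add: l sec_mod)
    qed
    then show ?thesis
      using sr by (subst rcos_eq_iff[OF N'.is_subgroup]) (simp_all add: sec_mult sec_inv)
  qed
  ultimately have fin: "finite ((\<lambda>s. H (Suc n) #> s) ` S)"
    by (rule finite_image_if_determined)
  have "rcosets (H (Suc n)) \<subseteq>
      (\<lambda>(C, i). C #> (a [^] i)) ` (((\<lambda>s. H (Suc n) #> s) ` S) \<times> {0..<int p})"
  proof
    fix C assume "C \<in> rcosets (H (Suc n))"
    then obtain g where g: "g \<in> carrier G" "C = H (Suc n) #> g"
      by (auto simp: RCOSETS_def)
    obtain i s where s: "s \<in> S" "g = a [^] (i :: int) \<otimes> s"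
      using g(1) by (rule decompose)
    have "a [^] i = a [^] (i mod int p)"
      by (rule a_pow_cong) simp
    then have "g = shift s (- i) \<otimes> a [^] (i mod int p)"
      using s by (simp add: shift_def int_pow_neg word_simps)
    then have "C = (H (Suc n) #> shift s (- i)) #> (a [^] (i mod int p))"
      using g(2) s N'.subset by (simp add: coset_mult_assoc del: H.simps)
    moreover have "shift s (- i) \<in> S" "i mod int p \<in> {0..<int p}"
      using s p_pos by auto
    ultimately show "C \<in> (\<lambda>(C, i). C #> (a [^] i)) ` (((\<lambda>s. H (Suc n) #> s) ` S) \<times> {0..<int p})"
      by blast
  qed
  then show ?case
    by (rule finite_subset) (use fin in auto)
qed

theorem H_quotient_p_group: "finite_p_group p (G Mod H n)"
  unfolding finite_p_group_def
proof (intro conjI)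
  interpret q: group_hom G "G Mod H n" "\<lambda>x. H n #> x"
    by (rule mod_hom[OF H_normal])
  show "group (G Mod H n)" by (rule q.H.is_group)
  show fin: "finite (carrier (G Mod H n))"
    using finite_index_H by (simp add: FactGroup_def)
  show "\<exists>k. order (G Mod H n) = p ^ k"
  proof (rule q.H.order_prime_power[OF fin p_prime])
    fix x assume "x \<in> carrier (G Mod H n)"
    then obtain g where g: "g \<in> carrier G" "x = H n #> g" by (auto simp: carrier_FactGroup)
    then have "x [^]\<^bsub>G Mod H n\<^esub> (p ^ Suc n) = \<one>\<^bsub>G Mod H n\<^esub>"
      using prime_power_in_H[OF g(1), of n] mem_normal_iff[OF H_normal, of "g [^] (p ^ Suc n)"]
      by (simp add: q.hom_nat_pow del: power_Suc)
    then show "\<exists>m. x [^]\<^bsub>G Mod H n\<^esub> (p ^ m) = \<one>\<^bsub>G Mod H n\<^esub>" by blast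
  qed
qed

end

section \<open>Automorphisms of the rooted tree\<close>

lemma tree_aut_simps [simp]:
  "g \<otimes>\<^bsub>tree_aut p\<^esub> h = h \<circ> g" "\<one>\<^bsub>tree_aut p\<^esub> = id"
  by (simp_all add: tree_aut_def)

lemma mem_tree_aut:
  "g \<in> carrier (tree_aut p) \<longleftrightarrow> g permutes words p \<and> g [] = [] \<and>
    (\<forall>u\<in>words p. \<forall>v\<in>words p. adjacent (g u) (g v) \<longleftrightarrow> adjacent u v)"
  unfolding tree_aut_def by (simp only: partial_object.simps mem_Collect_eq)

lemma tree_aut_permutes: "g \<in> carrier (tree_aut p) \<Longrightarrow> g permutes words p"
  by (simp add: mem_tree_aut)

lemma tree_aut_Nil [simp]: "g \<in> carrier (tree_aut p) \<Longrightarrow> g [] = []"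
  by (simp add: mem_tree_aut)

lemma tree_aut_outside: "g \<in> carrier (tree_aut p) \<Longrightarrow> w \<notin> words p \<Longrightarrow> g w = w"
  using tree_aut_permutes permutes_not_in by metis

lemma tree_aut_words_iff: "g \<in> carrier (tree_aut p) \<Longrightarrow> g w \<in> words p \<longleftrightarrow> w \<in> words p"
  using tree_aut_permutes permutes_in_image by metis

lemma tree_aut_inj: "g \<in> carrier (tree_aut p) \<Longrightarrow> g v = g w \<longleftrightarrow> v = w"
  using tree_aut_permutes permutes_inj inj_eq by metis

lemma tree_aut_adjacent:
  "g \<in> carrier (tree_aut p) \<Longrightarrow> u \<in> words p \<Longrightarrow> v \<in> words p \<Longrightarrow>
    adjacent (g u) (g v) \<longleftrightarrow> adjacent u v"
  unfolding mem_tree_aut by blast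

lemma adjacent_snoc [simp]: "adjacent u (u @ [x])" "adjacent (u @ [x]) u"
  by (simp_all add: adjacent_def)

text \<open>The image of a child is a child of the image: the only other neighbour of the image is
  its parent, which by induction is already the image of the parent.\<close>

lemma tree_aut_snoc:
  assumes g: "g \<in> carrier (tree_aut p)" and "u @ [x] \<in> words p"
  shows "\<exists>y. g (u @ [x]) = g u @ [y]"
  using assms(2)
proof (induction u arbitrary: x rule: rev_induct)
  case Nil
  then have "adjacent (g []) (g [x])"
    using tree_aut_adjacent[OF g, of "[]" "[x]"] adjacent_snoc(1)[of "[]" x] by simp
  then show ?case using g by (auto simp: adjacent_def)
next
  case (snoc z u)
  then have w: "u @ [z] \<in> words p" "u @ [z, x] \<in> words p" by auto
  then obtain y where y: "g (u @ [z]) = g u @ [y]" using snoc.IH by blast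
  have "adjacent (g (u @ [z])) (g (u @ [z, x]))"
    using tree_aut_adjacent[OF g w] adjacent_snoc(1)[of "u @ [z]" x] by simp
  then consider x' where "g (u @ [z, x]) = g (u @ [z]) @ [x']" | x' where "g (u @ [z]) = g (u @ [z, x]) @ [x']"
    by (auto simp: adjacent_def)
  then show ?case
  proof cases
    case 2
    then have "g u = g (u @ [z, x])" using y by simp
    then show ?thesis using tree_aut_inj[OF g] by simp
  qed simp
qed

lemma tree_autI:
  assumes "g permutes words p" "g [] = []"
    and snoc: "\<And>u x. u @ [x] \<in> words p \<Longrightarrow> \<exists>y. g (u @ [x]) = g u @ [y]"
  shows "g \<in> carrier (tree_aut p)"
proof -
  have inj: "g v = g w \<longleftrightarrow> v = w" for v w
    using assms(1) permutes_inj inj_eq by metis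
  have down: "\<exists>x. v = u @ [x]" if "u \<in> words p" "v \<in> words p" "g v = g u @ [y]" for u v y
  proof (cases v rule: rev_cases)
    case Nil
    then show ?thesis using that assms(2) by simp
  next
    case (snoc v' x)
    then show ?thesis using assms(3)[of v' x] that inj by auto
  qed
  have "adjacent (g u) (g v) \<longleftrightarrow> adjacent u v" if "u \<in> words p" "v \<in> words p" for u v
    using that snoc down unfolding adjacent_def by metis
  with assms(1,2) show ?thesis unfolding mem_tree_aut by blast
qed

lemma group_tree_aut: "group (tree_aut p)"
proof (rule groupI)
  fix g assume g: "g \<in> carrier (tree_aut p)"
  let ?h = "inv_into UNIV g"
  have perm: "?h permutes words p"
    using g tree_aut_permutes permutes_inv by blast
  have gh: "g (?h w) = w" for w
    using g tree_aut_permutes permutes_inverses(1) by metis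
  have hg: "?h (g w) = w" for w
    using g tree_aut_permutes permutes_inverses(2) by metis
  have "adjacent (?h u) (?h v) \<longleftrightarrow> adjacent u v" if "u \<in> words p" "v \<in> words p" for u v
  proof -
    have "?h u \<in> words p" "?h v \<in> words p" using that perm permutes_in_image by metis+
    then show ?thesis using tree_aut_adjacent[OF g, of "?h u" "?h v"] gh by simp
  qed
  moreover have "?h [] = []" using hg[of "[]"] g by simp
  ultimately have "?h \<in> carrier (tree_aut p)" using perm unfolding mem_tree_aut by blast
  then show "\<exists>h\<in>carrier (tree_aut p). h \<otimes>\<^bsub>tree_aut p\<^esub> g = \<one>\<^bsub>tree_aut p\<^esub>"
    using gh by (intro bexI[of _ ?h]) auto
next
  fix g h assume gh: "g \<in> carrier (tree_aut p)" "h \<in> carrier (tree_aut p)"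
  show "g \<otimes>\<^bsub>tree_aut p\<^esub> h \<in> carrier (tree_aut p)"
  proof (rule tree_autI)
    show "(g \<otimes>\<^bsub>tree_aut p\<^esub> h) permutes words p"
      using permutes_compose[OF gh[THEN tree_aut_permutes]] by simp
    fix u x assume w: "u @ [x] \<in> words p"
    then obtain y where y: "g (u @ [x]) = g u @ [y]" using gh tree_aut_snoc by blast
    then have "g u @ [y] \<in> words p" using w gh tree_aut_words_iff by metis
    then show "\<exists>y. (g \<otimes>\<^bsub>tree_aut p\<^esub> h) (u @ [x]) = (g \<otimes>\<^bsub>tree_aut p\<^esub> h) u @ [y]"
      using y gh tree_aut_snoc by fastforce
  qed (use gh in simp)
qed (auto intro: tree_autI permutes_id simp: o_assoc)

lemma tree_aut_inv_apply:
  assumes "g \<in> carrier (tree_aut p)"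
  shows "g ((inv\<^bsub>tree_aut p\<^esub> g) w) = w" "(inv\<^bsub>tree_aut p\<^esub> g) (g w) = w"
  using fun_cong[OF group.l_inv[OF group_tree_aut assms], of w]
    fun_cong[OF group.r_inv[OF group_tree_aut assms], of w] by simp_all

lemma tree_aut_append:
  assumes "g \<in> carrier (tree_aut p)" "u @ w \<in> words p"
  shows "\<exists>w'. g (u @ w) = g u @ w' \<and> length w' = length w"
  using assms(2)
proof (induction w rule: rev_induct)
  case (snoc x w)
  then obtain w' where "g (u @ w) = g u @ w'" "length w' = length w" by auto
  moreover obtain y where "g ((u @ w) @ [x]) = g (u @ w) @ [y]"
    using tree_aut_snoc[OF assms(1), of "u @ w" x] snoc by auto
  ultimately show ?case by simp
qed simp

lemma tree_aut_length: "g \<in> carrier (tree_aut p) \<Longrightarrow> length (g u) = length u"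
  using tree_aut_append[of g p "[]" u] tree_aut_outside[of g p u] by (cases "u \<in> words p") auto

lemma section_at_append:
  assumes "g \<in> carrier (tree_aut p)" "u @ w \<in> words p \<or> g u = u"
  shows "g (u @ w) = g u @ section_at g u w"
proof (cases "u @ w \<in> words p")
  case True
  then show ?thesis
    using tree_aut_append[OF assms(1) True] tree_aut_length[OF assms(1), of u]
    by (auto simp: section_at_def)
next
  case False
  then show ?thesis
    using assms(2) tree_aut_outside[OF assms(1) False] by (auto simp: section_at_def simp del: append_in_lists_conv)
qed

lemma section_at_outside:
  "g \<in> carrier (tree_aut p) \<Longrightarrow> w \<notin> words p \<Longrightarrow> section_at g u w = w"
  using tree_aut_outside[of g p "u @ w"] by (simp add: section_at_def)

lemma section_at_mult:
  assumes g: "g \<in> carrier (tree_aut p)" and h: "h \<in> carrier (tree_aut p)" and u: "u \<in> words p"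
  shows "section_at (g \<otimes>\<^bsub>tree_aut p\<^esub> h) u = section_at g u \<otimes>\<^bsub>tree_aut p\<^esub> section_at h (g u)"
proof
  fix w
  show "section_at (g \<otimes>\<^bsub>tree_aut p\<^esub> h) u w = (section_at g u \<otimes>\<^bsub>tree_aut p\<^esub> section_at h (g u)) w"
  proof (cases "w \<in> words p")
    case True
    then have "u @ w \<in> words p" using u by simp
    then have "g (u @ w) = g u @ section_at g u w" by (intro section_at_append[OF g]) simp
    then show ?thesis
      using tree_aut_length[OF g, of u] by (simp add: section_at_def)
  next
    case False
    then show ?thesis
      using g h group.is_monoid[OF group_tree_aut] monoid.m_closed[of "tree_aut p" g h]
      by (simp add: section_at_outside del: tree_aut_simps(1)) (simp add: section_at_outside)
  qed
qed

lemma section_at_one [simp]: "section_at id u = id"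
  by (auto simp: section_at_def)

lemma section_at_closed:
  assumes g: "g \<in> carrier (tree_aut p)" and u: "u \<in> words p"
  shows "section_at g u \<in> carrier (tree_aut p)"
proof (rule tree_autI)
  interpret T: group "tree_aut p" by (rule group_tree_aut)
  have cancel: "section_at (inv\<^bsub>tree_aut p\<^esub> h) (h v) \<circ> section_at h v = id"
    if "h \<in> carrier (tree_aut p)" "v \<in> words p" for h v
    using section_at_mult[of h p "inv\<^bsub>tree_aut p\<^esub> h" v] that by (simp del: tree_aut_simps(1)) simp
  let ?s = "section_at g u" and ?s' = "section_at (inv\<^bsub>tree_aut p\<^esub> g) (g u)"
  have "?s' \<circ> ?s = id" using cancel g u .
  moreover have "?s \<circ> ?s' = id"
    using cancel[of "inv\<^bsub>tree_aut p\<^esub> g" "g u"] g u tree_aut_words_iff[OF g, of u]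
    by (simp add: tree_aut_inv_apply)
  ultimately have "bij ?s" by (rule o_bij)
  then show "?s permutes words p"
    using section_at_outside[OF g] by (auto simp: permutes_def bij_iff)
  show "?s [] = []" using tree_aut_length[OF g, of u] by (simp add: section_at_def)
  fix w x assume w: "w @ [x] \<in> words p"
  then obtain y where "g ((u @ w) @ [x]) = g (u @ w) @ [y]"
    using tree_aut_snoc[OF g, of "u @ w" x] u by auto
  then show "\<exists>y. ?s (w @ [x]) = ?s w @ [y]"
    using tree_aut_length[OF g, of "u @ w"] by (simp add: section_at_def)
qed

lemma section_at_section_at: "section_at (section_at g u) v = section_at g (u @ v)"
  by (simp add: section_at_def add.commute)

lemma section_at_inv:
  assumes g: "g \<in> carrier (tree_aut p)" and u: "u \<in> words p"
  shows "section_at (inv\<^bsub>tree_aut p\<^esub> g) (g u) = inv\<^bsub>tree_aut p\<^esub> (section_at g u)"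
proof -
  interpret T: group "tree_aut p" by (rule group_tree_aut)
  have "section_at g u \<otimes>\<^bsub>tree_aut p\<^esub> section_at (inv\<^bsub>tree_aut p\<^esub> g) (g u) = \<one>\<^bsub>tree_aut p\<^esub>"
    using section_at_mult[of g p "inv\<^bsub>tree_aut p\<^esub> g" u] assms by (simp del: tree_aut_simps(1))
  then show ?thesis
    using T.inv_equality[of "section_at g u"] T.inv_inv T.inv_comm assms
      section_at_closed tree_aut_words_iff T.inv_closed by metis
qed

lemma tree_aut_eqI:
  assumes g: "g \<in> carrier (tree_aut p)" and h: "h \<in> carrier (tree_aut p)"
    and "\<And>j. j < p \<Longrightarrow> g [j] = [j]" "\<And>j. j < p \<Longrightarrow> h [j] = [j]"
    and "\<And>j. j < p \<Longrightarrow> section_at g [j] = section_at h [j]"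
  shows "g = h"
proof
  fix w show "g w = h w"
  proof (cases w)
    case Nil
    then show ?thesis using g h by simp
  next
    case (Cons j v)
    show ?thesis
    proof (cases "j < p")
      case True
      then show ?thesis
        using section_at_append[OF g, of "[j]" v] section_at_append[OF h, of "[j]" v] assms Cons by simp
    next
      case False
      then show ?thesis using Cons tree_aut_outside[OF g] tree_aut_outside[OF h] by simp
    qed
  qed
qed

lemma nat_pow_tree_aut: "g [^]\<^bsub>tree_aut p\<^esub> (n :: nat) = g ^^ n"
  by (induction n) (auto simp: fun_eq_iff)

lemma bij_if_funpow_eq_id:
  assumes "f ^^ n = id" "n > 0"
  shows "bij f"
proof -
  obtain m where "n = Suc m" using assms(2) by (cases n) auto
  then have "f \<circ> f ^^ m = id" "f ^^ m \<circ> f = id"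
    using assms(1) by (simp_all add: fun_eq_iff funpow_swap1)
  then show ?thesis using o_bij by blast
qed

lemma tree_aut_if_funpow_eq_id:
  assumes "g ^^ n = id" "n > 0" "g [] = []" "\<And>w. w \<notin> words p \<Longrightarrow> g w = w"
    and "\<And>u x. u @ [x] \<in> words p \<Longrightarrow> \<exists>y. g (u @ [x]) = g u @ [y]"
  shows "g \<in> carrier (tree_aut p)"
proof (rule tree_autI)
  show "g permutes words p"
    using bij_if_funpow_eq_id[OF assms(1,2)] assms(4) by (auto simp: permutes_def bij_iff)
qed (use assms in auto)

section \<open>The generators\<close>

lemma gen_a_funpow:
  "j # w \<in> words p \<Longrightarrow> (gen_a p ^^ m) (j # w) = ((j + m) mod p) # w"
  by (induction m) (auto simp: mod_Suc_eq)

lemma gen_a_order: "gen_a p ^^ p = id"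
proof
  fix w
  show "(gen_a p ^^ p) w = id w"
  proof (cases w)
    case Nil
    have "(gen_a p ^^ m) [] = []" for m by (induction m) auto
    then show ?thesis using Nil by simp
  next
    case (Cons j v)
    have "(gen_a p ^^ m) w = w" if "w \<notin> words p" for m
      using that Cons by (induction m) auto
    then show ?thesis
      using Cons gen_a_funpow[of j v p p] by (cases "w \<in> words p") auto
  qed
qed

lemma gen_a_closed: "p > 0 \<Longrightarrow> gen_a p \<in> carrier (tree_aut p)"
proof (rule tree_aut_if_funpow_eq_id[OF gen_a_order])
  show "gen_a p w = w" if "w \<notin> words p" for w
    using that by (cases w) auto
  show "\<exists>y. gen_a p (u @ [x]) = gen_a p u @ [y]" if "u @ [x] \<in> words p" for u x
    using that by (cases u) auto
qed auto

text \<open>Both \<open>b\<close> and \<open>c\<close> satisfy such a recursion, with \<open>d = p - 1\<close> and \<open>d = 0\<close>. The \<open>p\<close>-th iterate of \<open>f\<close> is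
  the identity by induction on the word, and this also makes \<open>f\<close> bijective.\<close>

lemma directed_automorphism:
  fixes f :: "nat list \<Rightarrow> nat list" and e :: "nat \<Rightarrow> int"
  assumes p: "p > 0" and Nil: "f [] = []"
    and Cons: "\<And>j w. f (j # w) = (if j = d then j # f w
        else if j < p then j # (gen_a p [^]\<^bsub>tree_aut p\<^esub> e j) w else j # w)"
    and d: "d < p"
  shows "f \<in> carrier (tree_aut p)" "f [^]\<^bsub>tree_aut p\<^esub> p = \<one>\<^bsub>tree_aut p\<^esub>"
proof -
  interpret T: group "tree_aut p" by (rule group_tree_aut)
  let ?A = "\<lambda>j. gen_a p [^]\<^bsub>tree_aut p\<^esub> e j"
  have A: "?A j \<in> carrier (tree_aut p)" for j
    using gen_a_closed[OF p] by simp
  have "?A j [^]\<^bsub>tree_aut p\<^esub> p = \<one>\<^bsub>tree_aut p\<^esub>" for j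
  proof -
    have "gen_a p [^]\<^bsub>tree_aut p\<^esub> int p = \<one>\<^bsub>tree_aut p\<^esub>"
      using gen_a_order by (simp add: int_pow_int nat_pow_tree_aut)
    then have "(gen_a p [^]\<^bsub>tree_aut p\<^esub> int p) [^]\<^bsub>tree_aut p\<^esub> e j = \<one>\<^bsub>tree_aut p\<^esub>"
      by (simp del: tree_aut_simps)
    then show ?thesis
      using gen_a_closed[OF p]
      by (simp add: T.int_pow_pow mult.commute flip: int_pow_int del: tree_aut_simps)
  qed
  then have A_order: "(?A j ^^ p) w = w" for j w
    by (simp add: nat_pow_tree_aut)
  have iter: "(f ^^ m) (j # w) = (if j = d then j # (f ^^ m) w
      else if j < p then j # (?A j ^^ m) w else j # w)" for m j w
    by (induction m) (auto simp: Cons)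
  have order: "(f ^^ p) w = w" for w
  proof (induction w)
    case Nil
    have "(f ^^ m) [] = []" for m by (induction m) (auto simp: assms(2))
    then show ?case by simp
  qed (simp add: iter A_order)
  show "f \<in> carrier (tree_aut p)"
  proof (rule tree_aut_if_funpow_eq_id[where g = f and n = p])
    show "f ^^ p = id" "p > 0" "f [] = []" using order p assms(2) by auto
    show "f w = w" if "w \<notin> words p" for w
      using that
    proof (induction w)
      case (Cons j w)
      then show ?case using d tree_aut_outside[OF A] by (auto simp: assms(3))
    qed simp
    show "\<exists>y. f (u @ [x]) = f u @ [y]" if "u @ [x] \<in> words p" for u x
      using that
    proof (induction u)
      case Nil
      then show ?case using tree_aut_Nil[OF A] by (simp add: assms(2,3))
    next
      case (Cons j u)
      then show ?case using tree_aut_snoc[OF A, of u x j] by (auto simp: assms(3))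
    qed
  qed
  show "f [^]\<^bsub>tree_aut p\<^esub> p = \<one>\<^bsub>tree_aut p\<^esub>"
    using order by (simp add: nat_pow_tree_aut fun_eq_iff)
qed

section \<open>The EGS-groups\<close>

locale egs_vector =
  fixes p :: nat and \<alpha> :: "nat \<Rightarrow> int"
  assumes p_prime: "prime p" and p_ge_3: "p \<ge> 3"
    and \<alpha>_carrier: "\<alpha> \<in> {1..p - 1} \<rightarrow> carrier (residue_ring (int p))"
    and nonsymmetric: "\<not> symmetric_vector p \<alpha>"
    and \<alpha>_sum: "(\<Oplus>\<^bsub>residue_ring (int p)\<^esub>i\<in>{1..p - 1}. \<alpha> i) = \<zero>\<^bsub>residue_ring (int p)\<^esub>"
begin

abbreviation T where "T \<equiv> tree_aut p"
abbreviation \<Gamma> where "\<Gamma> \<equiv> EGS p \<alpha>"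

text \<open>The vector as a function on the integers that depends on the residue class only. The value
  \<open>0\<close> at the multiples of \<open>p\<close>, where the vector has no entry, makes the sum over all residues \<open>0\<close>.\<close>

definition \<beta> :: "int \<Rightarrow> int" where
  "\<beta> k = (if int p dvd k then 0 else \<alpha> (nat (k mod int p)))"

definition S :: "(nat list \<Rightarrow> nat list) set" where
  "S = {g \<in> carrier \<Gamma>. \<forall>j<p. g [j] = [j]}"

definition sec :: "(nat list \<Rightarrow> nat list) \<Rightarrow> int \<Rightarrow> nat list \<Rightarrow> nat list" where
  "sec g k = section_at g [nat (k mod int p)]"

lemma p_pos: "p > 0"
  using p_ge_3 by simp

lemma index: "nat (k mod int p) < p" "int (nat (k mod int p)) = k mod int p"
  using p_pos by (simp_all add: nat_less_iff)

lemma \<alpha>_range: "i \<in> {1..p - 1} \<Longrightarrow> 0 \<le> \<alpha> i \<and> \<alpha> i < int p"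
  using \<alpha>_carrier by (auto simp: residue_ring_def Pi_iff)

lemma \<beta>_nat: "k \<in> {1..p - 1} \<Longrightarrow> \<beta> (int k) = \<alpha> k"
  using p_pos by (auto simp: \<beta>_def dest!: dvd_imp_le)

lemma finsum_residue:
  "finite I \<Longrightarrow> f \<in> I \<rightarrow> carrier (residue_ring (int p)) \<Longrightarrow>
    (\<Oplus>\<^bsub>residue_ring (int p)\<^esub>i\<in>I. f i) = (\<Sum>i\<in>I. f i) mod int p"
proof (induction I rule: finite_induct)
  case empty
  interpret residues "int p" "residue_ring (int p)"
    by unfold_locales (use p_ge_3 in simp_all)
  show ?case by (simp add: res_zero_eq)
next
  case (insert x I)
  interpret residues "int p" "residue_ring (int p)"
    by unfold_locales (use p_ge_3 in simp_all)
  show ?case using insert by (simp add: res_add_eq mod_add_right_eq Pi_iff)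
qed

lemma \<beta>_sum: "int p dvd (\<Sum>k<p. \<beta> (int k))"
proof -
  have "(\<Sum>k<p. \<beta> (int k)) = (\<Sum>k\<in>{1..p - 1}. \<beta> (int k))"
  proof (rule sum.mono_neutral_right)
    show "\<forall>k\<in>{..<p} - {1..p - 1}. \<beta> (int k) = 0"
    proof
      fix k assume "k \<in> {..<p} - {1..p - 1}"
      then have "k = 0" by auto
      then show "\<beta> (int k) = 0" by (simp add: \<beta>_def)
    qed
  qed (use p_pos in auto)
  also have "\<dots> = (\<Sum>k\<in>{1..p - 1}. \<alpha> k)"
    by (intro sum.cong \<beta>_nat) simp_all
  also have "\<dots> mod int p = 0"
    using \<alpha>_sum finsum_residue[OF _ \<alpha>_carrier] by (simp add: residue_ring_def)
  finally show ?thesis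
    using \<open>(\<Sum>k\<in>{1..p - 1}. \<alpha> k) mod int p = 0\<close> by (simp add: mod_eq_0_iff_dvd)
qed

lemma \<beta>_nonsymmetric: "\<exists>i. \<not> int p dvd \<beta> i - \<beta> (- i)"
proof -
  obtain i where i: "i \<in> {1..(p - 1) div 2}" "\<alpha> i \<noteq> \<alpha> (p - i)"
    using nonsymmetric by (auto simp: symmetric_vector_def)
  then have i': "i \<in> {1..p - 1}" "p - i \<in> {1..p - 1}" by auto
  have "\<beta> (- int i) = \<beta> (int (p - i))"
  proof -
    have eq: "(- int i) mod int p = int (p - i) mod int p"
    proof -
      have "int (p - i) = int p - int i" using i' by (intro of_nat_diff) auto
      then show ?thesis by (simp add: mod_eq_dvd_iff)
    qed
    then have "int p dvd - int i \<longleftrightarrow> int p dvd int (p - i)"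
      by (simp only: dvd_eq_mod_eq_0)
    with eq show ?thesis by (simp only: \<beta>_def)
  qed
  then have "\<beta> (int i) - \<beta> (- int i) = \<alpha> i - \<alpha> (p - i)"
    using i' by (simp add: \<beta>_nat)
  moreover have "\<not> int p dvd \<alpha> i - \<alpha> (p - i)"
  proof
    assume "int p dvd \<alpha> i - \<alpha> (p - i)"
    then have "\<alpha> i mod int p = \<alpha> (p - i) mod int p" by (simp add: mod_eq_dvd_iff)
    then show False using i(2) \<alpha>_range[OF i'(1)] \<alpha>_range[OF i'(2)] by simp
  qed
  ultimately show ?thesis by (intro exI[of _ "int i"]) simp
qed

sublocale T: group T
  by (rule group_tree_aut)

lemma gens_closed: "gen_a p \<in> carrier T" "gen_b p \<alpha> \<in> carrier T" "gen_c p \<alpha> \<in> carrier T"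
  and gens_order: "gen_a p [^]\<^bsub>T\<^esub> p = \<one>\<^bsub>T\<^esub>" "gen_b p \<alpha> [^]\<^bsub>T\<^esub> p = \<one>\<^bsub>T\<^esub>" "gen_c p \<alpha> [^]\<^bsub>T\<^esub> p = \<one>\<^bsub>T\<^esub>"
proof -
  show "gen_a p \<in> carrier T" "gen_a p [^]\<^bsub>T\<^esub> p = \<one>\<^bsub>T\<^esub>"
    using gen_a_closed[OF p_pos] gen_a_order by (simp_all add: nat_pow_tree_aut)
  show "gen_b p \<alpha> \<in> carrier T" "gen_b p \<alpha> [^]\<^bsub>T\<^esub> p = \<one>\<^bsub>T\<^esub>"
    by (rule directed_automorphism[OF p_pos, where f = "gen_b p \<alpha>" and d = "p - 1" and e = "\<lambda>j. \<alpha> (j + 1)"];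
        use p_pos in auto)+
  show "gen_c p \<alpha> \<in> carrier T" "gen_c p \<alpha> [^]\<^bsub>T\<^esub> p = \<one>\<^bsub>T\<^esub>"
    by (rule directed_automorphism[OF p_pos, where f = "gen_c p \<alpha>" and d = 0 and e = \<alpha>];
        use p_pos in auto)+
qed

lemma carrier_\<Gamma>: "carrier \<Gamma> = generate T {gen_a p, gen_b p \<alpha>, gen_c p \<alpha>}"
  by (simp add: EGS_def)

lemma \<Gamma>_eq: "\<Gamma> = T\<lparr>carrier := carrier \<Gamma>\<rparr>"
  by (simp add: EGS_def)

lemma \<Gamma>_subgroup: "subgroup (carrier \<Gamma>) T"
  unfolding carrier_\<Gamma> by (rule T.generate_is_subgroup) (use gens_closed in simp)

lemma \<Gamma>_carrier_T: "g \<in> carrier \<Gamma> \<Longrightarrow> g \<in> carrier T"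
  using subgroup.mem_carrier[OF \<Gamma>_subgroup] .

lemma \<Gamma>_simps [simp]: "g \<otimes>\<^bsub>\<Gamma>\<^esub> h = h \<circ> g" "\<one>\<^bsub>\<Gamma>\<^esub> = id"
  by (subst \<Gamma>_eq, simp)+

lemma \<Gamma>_inv: "g \<in> carrier \<Gamma> \<Longrightarrow> inv\<^bsub>\<Gamma>\<^esub> g = inv\<^bsub>T\<^esub> g"
  by (subst \<Gamma>_eq) (rule T.m_inv_consistent[OF \<Gamma>_subgroup])

lemma \<Gamma>_int_pow: "g \<in> carrier \<Gamma> \<Longrightarrow> g [^]\<^bsub>\<Gamma>\<^esub> (n :: int) = g [^]\<^bsub>T\<^esub> n"
  by (subst \<Gamma>_eq) (rule T.int_pow_consistent[OF \<Gamma>_subgroup, symmetric])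

lemma \<Gamma>_nat_pow: "g [^]\<^bsub>\<Gamma>\<^esub> (n :: nat) = g [^]\<^bsub>T\<^esub> n"
  by (subst \<Gamma>_eq) (rule T.nat_pow_consistent[symmetric])

lemma gens_\<Gamma>: "gen_a p \<in> carrier \<Gamma>" "gen_b p \<alpha> \<in> carrier \<Gamma>" "gen_c p \<alpha> \<in> carrier \<Gamma>"
  unfolding carrier_\<Gamma> by (auto intro: generate.incl)

lemma generate_\<Gamma>: "generate \<Gamma> {gen_a p, gen_b p \<alpha>, gen_c p \<alpha>} = carrier \<Gamma>"
proof -
  have "generate \<Gamma> {gen_a p, gen_b p \<alpha>, gen_c p \<alpha>} = generate T {gen_a p, gen_b p \<alpha>, gen_c p \<alpha>}"
    by (subst \<Gamma>_eq) (rule T.generate_consistent[OF _ \<Gamma>_subgroup], use gens_\<Gamma> in simp)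
  then show ?thesis by (simp add: carrier_\<Gamma>)
qed

lemma letter: "j < p \<Longrightarrow> [j] \<in> words p"
  by simp

lemma level_one_image:
  assumes "g \<in> carrier T" "j < p"
  obtains j' where "j' < p" "g [j] = [j']"
proof -
  have "length (g [j]) = 1" "g [j] \<in> words p"
    using tree_aut_length[OF assms(1)] tree_aut_words_iff[OF assms(1)] assms(2) by auto
  then show thesis using that by (cases "g [j]") auto
qed

lemma section_gen_a: "section_at (gen_a p) [j] = id"
  by (auto simp: section_at_def)

lemma section_gen_b:
  "j < p \<Longrightarrow> section_at (gen_b p \<alpha>) [j] = (if j = p - 1 then gen_b p \<alpha> else gen_a p [^]\<^bsub>T\<^esub> \<alpha> (j + 1))"
  by (auto simp: section_at_def fun_eq_iff)

lemma section_gen_c: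
  "j < p \<Longrightarrow> section_at (gen_c p \<alpha>) [j] = (if j = 0 then gen_c p \<alpha> else gen_a p [^]\<^bsub>T\<^esub> \<alpha> j)"
  by (auto simp: section_at_def)

lemma section_in_\<Gamma>:
  assumes "g \<in> carrier \<Gamma>" "j < p"
  shows "section_at g [j] \<in> carrier \<Gamma>"
proof -
  have gens: "section_at g [j] \<in> carrier \<Gamma>"
    if "g \<in> {gen_a p, gen_b p \<alpha>, gen_c p \<alpha>}" "j < p" for g j
  proof -
    have "gen_a p [^]\<^bsub>T\<^esub> n \<in> carrier \<Gamma>" for n :: int
      by (intro T.subgroup_int_pow_closed \<Gamma>_subgroup gens_\<Gamma>)
    moreover have "id \<in> carrier \<Gamma>"
      using subgroup.one_closed[OF \<Gamma>_subgroup] by simp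
    ultimately show ?thesis
      using that gens_\<Gamma> by (auto simp: section_gen_a section_gen_b section_gen_c)
  qed
  show ?thesis
    using assms unfolding carrier_\<Gamma>
  proof (induction g arbitrary: j rule: generate.induct)
    case one
    then show ?case
      using subgroup.one_closed[OF \<Gamma>_subgroup] by (simp only: tree_aut_simps section_at_one carrier_\<Gamma>)
  next
    case (incl h)
    then show ?case using gens by (simp add: carrier_\<Gamma>)
  next
    case (inv h)
    then have h: "h \<in> carrier T" using gens_closed by auto
    obtain j' where j': "j' < p" "(inv\<^bsub>T\<^esub> h) [j] = [j']"
      using inv(2) h T.inv_closed by (metis level_one_image)
    then have "h [j'] = [j]" using tree_aut_inv_apply(1)[OF h, of "[j]"] by simp
    then have "section_at (inv\<^bsub>T\<^esub> h) [j] = inv\<^bsub>T\<^esub> (section_at h [j'])"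
      using section_at_inv[OF h letter[OF j'(1)]] by simp
    then show ?case
      using gens[OF inv(1) j'(1)] subgroup.m_inv_closed[OF \<Gamma>_subgroup] by (simp add: carrier_\<Gamma>)
  next
    case (eng g h)
    then have gh: "g \<in> carrier T" "h \<in> carrier T"
      using \<Gamma>_carrier_T by (simp_all add: carrier_\<Gamma>)
    obtain j' where j': "j' < p" "g [j] = [j']"
      using level_one_image[OF gh(1) eng(5)] .
    then show ?case
      using section_at_mult[OF gh letter[OF eng(5)]] eng generate.eng by metis
  qed
qed

lemma S_mem: "g \<in> S \<longleftrightarrow> g \<in> carrier \<Gamma> \<and> (\<forall>j<p. g [j] = [j])"
  by (simp add: S_def)

lemma S_carrier_T: "g \<in> S \<Longrightarrow> g \<in> carrier T"
  by (simp add: S_mem \<Gamma>_carrier_T)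

lemma S_fixes: "g \<in> S \<Longrightarrow> j < p \<Longrightarrow> g [j] = [j]"
  by (simp add: S_mem)

lemma inv_fixes: "g \<in> carrier T \<Longrightarrow> g w = w \<Longrightarrow> (inv\<^bsub>T\<^esub> g) w = w"
  using tree_aut_inv_apply(2) by metis

lemma group_\<Gamma>: "group \<Gamma>"
  using T.subgroup_imp_group[OF \<Gamma>_subgroup] by (simp flip: \<Gamma>_eq)

lemma S_normal: "S \<lhd> \<Gamma>"
  unfolding group.normal_inv_iff[OF group_\<Gamma>]
proof (intro conjI ballI)
  interpret G: group \<Gamma> by (rule group_\<Gamma>)
  show "subgroup S \<Gamma>"
  proof (rule G.subgroupI)
    show "inv\<^bsub>\<Gamma>\<^esub> g \<in> S" if "g \<in> S" for g
      using that \<Gamma>_carrier_T G.inv_closed[of g] by (auto simp: S_mem \<Gamma>_inv inv_fixes)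
    show "g \<otimes>\<^bsub>\<Gamma>\<^esub> h \<in> S" if "g \<in> S" "h \<in> S" for g h
      using that G.m_closed[of g h] by (auto simp: S_mem)
    have "id \<in> S" using G.one_closed by (simp add: S_mem)
    then show "S \<noteq> {}" by blast
  qed (auto simp: S_mem)
  fix x g assume x: "x \<in> carrier \<Gamma>" and g: "g \<in> S"
  have "(x \<otimes>\<^bsub>\<Gamma>\<^esub> g \<otimes>\<^bsub>\<Gamma>\<^esub> inv\<^bsub>\<Gamma>\<^esub> x) [j] = [j]" if j: "j < p" for j
  proof -
    obtain j' where "j' < p" "x [j] = [j']"
      using level_one_image[OF \<Gamma>_carrier_T[OF x] j] .
    then show ?thesis
      using g x tree_aut_inv_apply(2)[OF \<Gamma>_carrier_T[OF x], of "[j]"] by (simp add: S_mem \<Gamma>_inv)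
  qed
  moreover have "x \<otimes>\<^bsub>\<Gamma>\<^esub> g \<otimes>\<^bsub>\<Gamma>\<^esub> inv\<^bsub>\<Gamma>\<^esub> x \<in> carrier \<Gamma>"
    using x g G.m_closed G.inv_closed by (simp add: S_mem del: \<Gamma>_simps)
  ultimately show "x \<otimes>\<^bsub>\<Gamma>\<^esub> g \<otimes>\<^bsub>\<Gamma>\<^esub> inv\<^bsub>\<Gamma>\<^esub> x \<in> S" by (simp add: S_mem)
qed

lemma sec_conj_a:
  assumes g: "g \<in> S"
  shows "sec (inv\<^bsub>\<Gamma>\<^esub> (gen_a p) \<otimes>\<^bsub>\<Gamma>\<^esub> g \<otimes>\<^bsub>\<Gamma>\<^esub> gen_a p) k = sec g (k - 1)"
proof -
  define j j' where "j = nat (k mod int p)" and "j' = nat ((k - 1) mod int p)"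
  have j: "j < p" "j' < p" using index by (simp_all add: j_def j'_def)
  let ?a = "gen_a p" and ?a' = "inv\<^bsub>T\<^esub> (gen_a p)"
  have "int ((j' + 1) mod p) = int j"
    using p_pos mod_add_right_eq[of 1 "k - 1" "int p"] by (simp add: j_def j'_def zmod_int)
  then have aj: "?a [j'] = [j]"
    using j by simp
  then have a'j: "?a' [j] = [j']"
    using tree_aut_inv_apply(2)[OF gens_closed(1), of "[j']"] by simp
  have "section_at ?a' [j] = inv\<^bsub>T\<^esub> (section_at ?a [j'])"
    using section_at_inv[OF gens_closed(1) letter[OF j(2)]] aj by simp
  then have sec_a': "section_at ?a' [j] = id"
    using T.inv_one by (simp add: section_gen_a)
  have gT: "g \<in> carrier T" "g [j'] = [j']"
    using g j by (auto simp: S_mem \<Gamma>_carrier_T)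
  have "section_at (?a' \<otimes>\<^bsub>T\<^esub> (g \<otimes>\<^bsub>T\<^esub> ?a)) [j]
      = section_at ?a' [j] \<otimes>\<^bsub>T\<^esub> (section_at g [j'] \<otimes>\<^bsub>T\<^esub> section_at ?a [j'])"
    using gT gens_closed(1) j a'j
    by (simp add: section_at_mult letter del: tree_aut_simps)
  then show ?thesis
    by (simp add: sec_a' section_gen_a sec_def \<Gamma>_inv gens_\<Gamma> o_assoc flip: j_def j'_def)
qed

sublocale E: egs_sections \<Gamma> p \<beta> "gen_a p" "gen_b p \<alpha>" "gen_c p \<alpha>" S sec
proof (intro egs_sections.intro egs_sections_axioms.intro)
  show "group \<Gamma>" by (rule group_\<Gamma>)
  show "prime p" by (rule p_prime)
  show "\<beta> k = 0" if "int p dvd k" for k using that by (simp add: \<beta>_def)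
  show "\<beta> (k mod int p) = \<beta> k" for k by (simp add: \<beta>_def dvd_mod_iff)
  show "int p dvd (\<Sum>k<p. \<beta> (int k))" by (rule \<beta>_sum)
  show "\<exists>i. \<not> int p dvd \<beta> i - \<beta> (- i)" by (rule \<beta>_nonsymmetric)
  show "gen_a p \<in> carrier \<Gamma>" "gen_b p \<alpha> \<in> carrier \<Gamma>" "gen_c p \<alpha> \<in> carrier \<Gamma>" by (rule gens_\<Gamma>)+
  show "generate \<Gamma> {gen_a p, gen_b p \<alpha>, gen_c p \<alpha>} = carrier \<Gamma>" by (rule generate_\<Gamma>)
  show "gen_a p [^]\<^bsub>\<Gamma>\<^esub> p = \<one>\<^bsub>\<Gamma>\<^esub>" "gen_b p \<alpha> [^]\<^bsub>\<Gamma>\<^esub> p = \<one>\<^bsub>\<Gamma>\<^esub>" "gen_c p \<alpha> [^]\<^bsub>\<Gamma>\<^esub> p = \<one>\<^bsub>\<Gamma>\<^esub>"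
    using gens_order by (simp_all add: \<Gamma>_nat_pow)
  show "S \<lhd> \<Gamma>" by (rule S_normal)
  have "gen_a p [0] \<noteq> [0]" using p_ge_3 by simp
  then show "gen_a p \<notin> S" using p_pos by (auto simp: S_mem)
  have Nil: "(gen_a p [^]\<^bsub>T\<^esub> n) [] = []" for n :: int
    using gens_closed(1) by (intro tree_aut_Nil[where p = p] T.int_pow_closed)
  show "gen_b p \<alpha> \<in> S" "gen_c p \<alpha> \<in> S" using gens_\<Gamma> by (auto simp: S_mem Nil)
  show "sec g k \<in> carrier \<Gamma>" if "g \<in> S" for g k
    using that index by (simp add: sec_def section_in_\<Gamma> S_mem)
  show "sec (g \<otimes>\<^bsub>\<Gamma>\<^esub> h) k = sec g k \<otimes>\<^bsub>\<Gamma>\<^esub> sec h k" if "g \<in> S" "h \<in> S" for g h k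
    using that section_at_mult[of g p h "[nat (k mod int p)]"] index \<Gamma>_carrier_T
    by (simp add: sec_def S_mem)
  show "sec g (k mod int p) = sec g k" for g k by (simp add: sec_def)
  show "g = \<one>\<^bsub>\<Gamma>\<^esub>" if g: "g \<in> S" and s: "\<And>k. sec g k = \<one>\<^bsub>\<Gamma>\<^esub>" for g
  proof -
    have "section_at g [j] = section_at id [j]" if "j < p" for j
      using s[of "int j"] that by (simp add: sec_def)
    then have "g = id"
      using g \<Gamma>_carrier_T T.one_closed by (intro tree_aut_eqI[of g p id]) (auto simp: S_mem)
    then show ?thesis by simp
  qed
  show "sec (inv\<^bsub>\<Gamma>\<^esub> (gen_a p) \<otimes>\<^bsub>\<Gamma>\<^esub> g \<otimes>\<^bsub>\<Gamma>\<^esub> gen_a p) k = sec g (k - 1)" if "g \<in> S" for g k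
    using that by (rule sec_conj_a)
  fix k :: int
  define j where "j = nat (k mod int p)"
  have j: "j < p" "int j = k mod int p" using index by (simp_all add: j_def)
  have k_dvd: "int p dvd k \<longleftrightarrow> j = 0"
    using j by (auto simp: dvd_eq_mod_eq_0)
  have succ: "(k + 1) mod int p = int (if j = p - 1 then 0 else j + 1)"
  proof -
    have "(k + 1) mod int p = (int j + 1) mod int p"
      by (simp add: j mod_add_left_eq)
    then show ?thesis using j(1) by (auto simp: of_nat_diff)
  qed
  then have k1_dvd: "int p dvd k + 1 \<longleftrightarrow> j = p - 1"
    by (auto simp: dvd_eq_mod_eq_0)
  show "sec (gen_b p \<alpha>) k = (if int p dvd k + 1 then gen_b p \<alpha> else gen_a p [^]\<^bsub>\<Gamma>\<^esub> \<beta> (k + 1))"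
    using section_gen_b[OF j(1)] succ
    by (simp add: sec_def \<beta>_def k1_dvd \<Gamma>_int_pow gens_\<Gamma> nat_add_distrib flip: j_def)
  show "sec (gen_c p \<alpha>) k = (if int p dvd k then gen_c p \<alpha> else gen_a p [^]\<^bsub>\<Gamma>\<^esub> \<beta> k)"
    using section_gen_c[OF j(1)]
    by (simp add: sec_def \<beta>_def k_dvd \<Gamma>_int_pow gens_\<Gamma> flip: j_def)
qed

lemma St_fixes: "g \<in> E.St n \<Longrightarrow> length w \<le> n \<Longrightarrow> g w = w"
proof (induction n arbitrary: g w)
  case 0
  then show ?case using tree_aut_Nil[OF \<Gamma>_carrier_T] by simp
next
  case (Suc n)
  then have g: "g \<in> carrier T" by (auto simp: S_carrier_T S_fixes)
  show ?case
  proof (cases w)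
    case Nil
    then show ?thesis using g by simp
  next
    case (Cons j v)
    show ?thesis
    proof (cases "j < p")
      case True
      then have "sec g (int j) v = v" "g [j] = [j]"
        using Suc Cons by (auto simp: S_fixes)
      then show ?thesis
        using section_at_append[OF g, of "[j]" v] True Cons by (simp add: sec_def)
    next
      case False
      then show ?thesis using Cons tree_aut_outside[OF g] by simp
    qed
  qed
qed

lemma St_faithful: "(\<And>n. g \<in> E.St n) \<Longrightarrow> g = \<one>\<^bsub>\<Gamma>\<^esub>"
  using St_fixes by fastforce

lemma H_subset_derived: "E.H n \<subseteq> derived \<Gamma> (carrier \<Gamma>)"
proof (induction n)
  case (Suc n)
  then show ?case using E.H_decreasing by blast
qed simp

text \<open>An automorphism of the tree in \<open>level_group p \<alpha> (Suc n)\<close> is in the group because, by \<open>E.G'_fill\<close>, some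
  element of the group has the same sections.\<close>

lemma level_group_eq_H: "level_group p \<alpha> n = E.H n"
proof (induction n)
  case 0
  have "section_at h [] = h" for h :: "nat list \<Rightarrow> nat list"
    by (simp add: section_at_def)
  moreover have "derived \<Gamma> (carrier \<Gamma>) \<subseteq> carrier T"
    using E.derived_carrier_subset \<Gamma>_carrier_T by blast
  ultimately show ?case by (auto simp: level_group_def)
next
  case (Suc n)
  show ?case
  proof (intro equalityI subsetI)
    fix h assume "h \<in> level_group p \<alpha> (Suc n)"
    then have h: "h \<in> carrier T"
      and fix_h: "\<And>v. v \<in> words p \<Longrightarrow> length v = Suc n \<Longrightarrow> h v = v"
      and sec_h: "\<And>v. v \<in> words p \<Longrightarrow> length v = Suc n \<Longrightarrow> section_at h v \<in> derived \<Gamma> (carrier \<Gamma>)"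
      by (auto simp: level_group_def)
    have fix_j: "h [j] = [j]" if j: "j < p" for j
    proof -
      have v: "[j] @ replicate n 0 \<in> words p" using j p_pos by (auto simp: in_lists_conv_set)
      then have "h ([j] @ replicate n 0) = [j] @ replicate n 0" by (intro fix_h) auto
      then show ?thesis
        using tree_aut_append[OF h v] tree_aut_length[OF h, of "[j]"] by (metis append_eq_append_conv)
    qed
    have level: "section_at h [j] \<in> E.H n" if j: "j < p" for j
    proof -
      have "section_at h [j] v = v" "section_at (section_at h [j]) v \<in> derived \<Gamma> (carrier \<Gamma>)"
        if "v \<in> words p" "length v = n" for v
        using that j fix_h[of "j # v"] sec_h[of "j # v"]
        by (simp_all add: section_at_section_at) (simp add: section_at_def)
      then show ?thesis
        unfolding Suc.IH[symmetric] using section_at_closed[OF h letter[OF j]]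
        by (simp add: level_group_def)
    qed
    have "\<exists>d\<in>third_lower_central \<Gamma> \<inter> S. \<forall>k. sec d k = sec h k"
    proof (rule E.G'_fill)
      show "sec h k \<in> derived \<Gamma> (carrier \<Gamma>)" for k
        using level[OF index(1)[of k]] H_subset_derived by (auto simp: sec_def[of h k])
    qed (simp add: sec_def)
    then obtain d where d: "d \<in> S" "\<And>k. sec d k = sec h k" by blast
    have "h = d"
    proof (rule tree_aut_eqI[OF h])
      show "section_at h [j] = section_at d [j]" if "j < p" for j
        using d(2)[of "int j"] that by (simp add: sec_def)
      show "d \<in> carrier T"
        using d(1) by (rule S_carrier_T)
      show "d [j] = [j]" if "j < p" for j
        using d(1) that by (rule S_fixes)
    qed (use fix_j in simp)
    then have "h \<in> S" using d(1) by simp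
    moreover have "sec h k \<in> E.H n" for k
      using level[OF index(1)[of k]] by (simp add: sec_def[of h k])
    ultimately show "h \<in> E.H (Suc n)" by simp
  next
    fix h assume h: "h \<in> E.H (Suc n)"
    then have hT: "h \<in> carrier T" and fix_j: "\<And>j. j < p \<Longrightarrow> h [j] = [j]"
      by (auto simp: S_carrier_T S_fixes)
    have "h v = v \<and> section_at h v \<in> derived \<Gamma> (carrier \<Gamma>)" if v: "v \<in> words p" "length v = Suc n" for v
    proof -
      obtain j w where jw: "v = j # w" "j < p" "w \<in> words p" "length w = n"
        using v by (cases v) auto
      have "sec h (int j) \<in> E.H n" using h by simp
      then have "section_at h [j] \<in> level_group p \<alpha> n"
        using jw(2) Suc.IH by (simp add: sec_def[of h])
      then have "section_at h [j] w = w" "section_at (section_at h [j]) w \<in> derived \<Gamma> (carrier \<Gamma>)"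
        using jw by (auto simp: level_group_def)
      then show ?thesis
        using section_at_append[OF hT, of "[j]" w] jw fix_j by (simp add: section_at_section_at)
    qed
    then show "h \<in> level_group p \<alpha> (Suc n)"
      using hT by (simp add: level_group_def)
  qed
qed

lemma egs_tower_normal: "egs_tower p \<alpha> n \<lhd> \<Gamma>"
  using E.H_normal E.normal_self by (simp add: egs_tower_def level_group_eq_H)

lemma egs_tower_decreasing: "egs_tower p \<alpha> (Suc n) \<subseteq> egs_tower p \<alpha> n"
  using E.H_decreasing[of n] normal_imp_subgroup[OF E.H_normal, of "Suc n"] subgroup.subset
  by (auto simp: egs_tower_def level_group_eq_H simp del: E.H.simps)

lemma egs_tower_p_group: "finite_p_group p (\<Gamma> Mod egs_tower p \<alpha> n)"
proof (cases n)
  case 0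
  have "rcosets\<^bsub>\<Gamma>\<^esub> (carrier \<Gamma>) = {carrier \<Gamma>}"
    using E.coset_join2[OF _ E.subgroup_self] E.one_closed by (auto simp: RCOSETS_def)
  then have "carrier (\<Gamma> Mod carrier \<Gamma>) = {carrier \<Gamma>}"
    by (simp add: FactGroup_def)
  then show ?thesis
    using 0 normal.factorgroup_is_group[OF E.normal_self]
    by (auto simp: finite_p_group_def egs_tower_def order_def intro: exI[of _ 0])
next
  case (Suc m)
  then show ?thesis
    using E.H_quotient_p_group[of n] by (simp add: egs_tower_def level_group_eq_H del: E.H.simps)
qed

lemma egs_tower_cofinal:
  assumes "N \<in> finite_index_normals \<Gamma>"
  shows "\<exists>n. egs_tower p \<alpha> n \<subseteq> N"
proof -
  obtain m where "E.H m \<subseteq> N"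
    using assms E.finite_index_contains_level[OF St_faithful] by (auto simp: finite_index_normals_def)
  then have "egs_tower p \<alpha> (Suc m) \<subseteq> N"
    using E.H_decreasing[of m] by (auto simp: egs_tower_def level_group_eq_H simp del: E.H.simps)
  then show ?thesis by blast
qed

end

theorem theorem3p3:
  fixes p :: nat and \<alpha> :: "nat \<Rightarrow> int"
  assumes "prime p" and "p \<ge> 3"
    and "\<alpha> \<in> {1..p - 1} \<rightarrow> carrier (residue_ring (int p))"
    and "\<not> symmetric_vector p \<alpha>"
    and "(\<Oplus>\<^bsub>residue_ring (int p)\<^esub>i\<in>{1..p - 1}. \<alpha> i) = \<zero>\<^bsub>residue_ring (int p)\<^esub>"
  shows "(\<forall>n. egs_tower p \<alpha> n \<lhd> EGS p \<alpha>
            \<and> finite_p_group p (EGS p \<alpha> Mod egs_tower p \<alpha> n)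
            \<and> quotient_projection (EGS p \<alpha>) (egs_tower p \<alpha> n)
                \<in> epi (EGS p \<alpha> Mod egs_tower p \<alpha> (Suc n)) (EGS p \<alpha> Mod egs_tower p \<alpha> n))
       \<and> (\<exists>\<Phi>. \<Phi> \<in> iso (profinite_completion (EGS p \<alpha>)) (tower_limit (EGS p \<alpha>) (egs_tower p \<alpha>))
            \<and> homeomorphic_map (profinite_topology (EGS p \<alpha>))
                (tower_topology (EGS p \<alpha>) (egs_tower p \<alpha>)) \<Phi>
            \<and> (\<forall>g\<in>carrier (EGS p \<alpha>).
                 \<Phi> (profinite_map (EGS p \<alpha>) g) = tower_map (EGS p \<alpha>) (egs_tower p \<alpha>) g))"
proof -
  interpret egs_vector p \<alpha>
    using assms by (rule egs_vector.intro)
  have "egs_tower p \<alpha> n \<in> finite_index_normals (EGS p \<alpha>)" for n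
    using egs_tower_normal[of n] egs_tower_p_group[of n]
    by (simp add: finite_index_normals_def finite_p_group_def FactGroup_def)
  from E.profinite_completion_cofinal_tower[OF this egs_tower_decreasing egs_tower_cofinal]
  show ?thesis
    using egs_tower_normal egs_tower_p_group
      E.quotient_projection_epi[OF egs_tower_normal egs_tower_normal egs_tower_decreasing]
    by blast
qed

end
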